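(* Let $\{\mathcal G,\Gamma_0,\Gamma_1\}$ be a quasi boundary triple for $T\subset A^*$ with $A_j=T\upharpoonright\ker\Gamma_j$, $j=0,1$, such that $A_1$ is self-adjoint in $\mathcal H$, there exists $\eta\in\rho(A_0)\cap\mathbb R$, and $\mathscr G_0=\operatorname{ran}(\Gamma_0\upharpoonright\ker\Gamma_1)$, $\mathscr G_1=\operatorname{ran}(\Gamma_1\upharpoonright\ker\Gamma_0)$ are dense in $\mathcal G$. Let $\widetilde\gamma$ and $\widetilde M$ be the extended $\gamma$-field and the extended Weyl function. Let $\vartheta\subset\mathscr G_1'\times\mathscr G_0'$ be a linear relation contained in $\operatorname{ran}\widetilde\Gamma$ such that the extension $$\widetilde A_\vartheta=A^*\upharpoonright\{f\in\operatorname{dom}A^*:\widetilde\Gamma f\in\vartheta\}$$ is closed in $\mathcal H$. Then for all $\lambda\in\rho(A_0)$ the following assertions hold. (i) $\lambda\in\sigma_p(\widetilde A_\vartheta)$ if and only if $0\in\sigma_p(\iota_+(\vartheta-\widetilde M(\lambda))\iota_-^{-1})$, and in this case $\ker(\widetilde A_\vartheta-\lambda)=\widetilde\gamma(\lambda)\ker(\vartheta-\widetilde M(\lambda))$. (ii) $\lambda\in\sigma_c(\widetilde A_\vartheta)$ if and only if $0\in\sigma_c(\iota_+(\vartheta-\widetilde M(\lambda))\iota_-^{-1})$. (iii) $\lambda\in\sigma_r(\widetilde A_\vartheta)$ if and only if $0\in\sigma_r(\iota_+(\vartheta-\widetilde M(\lambda))\iota_-^{-1})$. (iv) $\lambda\in\rho(\widetilde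 A_\vartheta)$ if and only if $0\in\rho(\iota_+(\vartheta-\widetilde M(\lambda))\iota_-^{-1})$, and $$(\widetilde A_\vartheta-\lambda)^{-1}=(A_0-\lambda)^{-1}+\widetilde\gamma(\lambda)\bigl(\vartheta-\widetilde M(\lambda)\bigr)^{-1}\widetilde\gamma(\bar\lambda)'$$ holds for all $\lambda\in\rho(\widetilde A_\vartheta)\cap\rho(A_0)$.
   Context: Inner products are linear in the first and antilinear in the second argument. $\mathcal H$ is a separable Hilbert space, $A$ is a closed, densely defined, symmetric operator in $\mathcal H$ with adjoint $A^*$. Quasi boundary triple: let $T\subset A^*$ be a linear operator in $\mathcal H$ with $\overline T=A^*$. A triple $\{\mathcal G,\Gamma_0,\Gamma_1\}$ is a quasi boundary triple for $T\subset A^*$ if $\mathcal G$ is a Hilbert space and $\Gamma_0,\Gamma_1:\operatorname{dom}T\to\mathcal G$ are linear maps such that (a) $(Tf,g)_{\mathcal H}-(f,Tg)_{\mathcal H}=(\Gamma_1f,\Gamma_0g)_{\mathcal G}-(\Gamma_0f,\Gamma_1g)_{\mathcal G}$ for all $f,g\in\operatorname{dom}T$; (b) $\Gamma=(\Gamma_0,\Gamma_1)^\top:\operatorname{dom}T\to\mathcal G\times\mathcal G$ has dense range; (c) $A_0:=T\upharpoonright\ker\Gamma_0$ is self-adjoint in $\mathcal H$. Norms and extensions: $\mathscr G_1$ is equipped with a norm such that $\mathscr G_1$ is a reflexive Banach space continuously embedded in $\mathcal G$ and $\Gamma_1(A_0-\bar\lambda)^{-1}:\mathcal H\to\mathscr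 G_1$ is continuous for some (equivalently all) $\lambda\in\rho(A_0)$; $\mathscr G_0$ is equipped with a norm such that $\mathscr G_0$ is a reflexive Banach space continuously embedded in $\mathcal G$ and $\Gamma_0(A_1-\bar\lambda)^{-1}:\mathcal H\to\mathscr G_0$ is continuous for some (equivalently all) $\lambda\in\rho(A_1)$ (such norms exist under the density assumptions and are unique up to equivalence). $\mathscr G_j'$ is the anti-dual of $\mathscr G_j$ (continuous antilinear functionals), $\mathscr G_j\hookrightarrow\mathcal G\hookrightarrow\mathscr G_j'$, with pairings extending $(\cdot,\cdot)_{\mathcal G}$. $\widetilde\Gamma_0:\operatorname{dom}A^*\to\mathscr G_1'$ and $\widetilde\Gamma_1:\operatorname{dom}A^*\to\mathscr G_0'$ are the unique extensions of $\Gamma_0,\Gamma_1$ that are continuous in the graph norm of $A^*$ (they exist and are surjective), and $\widetilde\Gamma=(\widetilde\Gamma_0,\widetilde\Gamma_1)^\top$. For $\lambda\in\rho(A_0)$, $\widetilde\Gamma_0\upharpoonright\ker(A^*-\lambda)$ is injective with range $\mathscr G_1'$; $\widetilde\gamma(\lambda):=(\widetilde\Gamma_0\upharpoonright\ker(A^*-\lambda))^{-1}:\mathscr G_1'\to\mathcal H$ (extended $\gamma$-field) and $\widetilde M(\lambda):=\widetilde\Gamma_1\widetilde\gamma(\lambda):\mathscr G_1'\to\mathscr G_0'$ (extended Weyl function) are bounded. The adjoint $\widetilde\gamma(\lambda)':\mathcal H\to\mathscr G_1$ is defined by $\langle\widetilde\gamma(\lambda)'h,x'\rangle_{\mathscr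 G_1\times\mathscr G_1'}=(h,\widetilde\gamma(\lambda)x')_{\mathcal H}$. $\iota_+:\mathscr G_1\to\mathcal G$ and $\iota_-:\mathscr G_1'\to\mathcal G$ are isometric isomorphisms with $(\iota_-x',\iota_+x)_{\mathcal G}=\langle x',x\rangle_{\mathscr G_1'\times\mathscr G_1}$ for $x\in\mathscr G_1$, $x'\in\mathscr G_1'$. Linear relations: a (closed) linear relation is a (closed) linear subspace of a product space; operators are identified with their graphs. Sum: $\Theta_1+\Theta_2=\{(x,x'+x'')^\top:(x,x')^\top\in\Theta_1,(x,x'')^\top\in\Theta_2\}$; product: $\Theta_2\Theta_1=\{(x,x'')^\top:(x,x')^\top\in\Theta_1,(x',x'')^\top\in\Theta_2\}$; inverse: $\Theta^{-1}=\{(x',x)^\top:(x,x')^\top\in\Theta\}$; $\ker\Theta=\{x:(x,0)^\top\in\Theta\}$; $\operatorname{ran}\Theta=\{x':(x,x')^\top\in\Theta\text{ for some }x\}$. Under the present assumptions $\vartheta-\widetilde M(\lambda)\subset\mathscr G_1'\times\mathscr G_1$, so $\iota_+(\vartheta-\widetilde M(\lambda))\iota_-^{-1}$ is a linear relation in $\mathcal G$. For a closed linear relation $\Theta$ in a Hilbert space: $\lambda\in\rho(\Theta)$ if $(\Theta-\lambda)^{-1}$ is a bounded everywhere defined operator; $\sigma(\Theta)=\mathbb C\setminus\rho(\Theta)$; $\sigma_p(\Theta)=\{\lambda:\ker(\Theta-\lambda)\ne\{0\}\}$; $\sigma_c(\Theta)=\{\lambda\notin\rho(\Theta):\ker(\Theta-\lambda)=\{0\},\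 \operatorname{ran}(\Theta-\lambda)\text{ dense}\}$; $\sigma_r(\Theta)=\{\lambda:\ker(\Theta-\lambda)=\{0\},\ \operatorname{ran}(\Theta-\lambda)\text{ not dense}\}$. *)

theory Defs
  imports "HOL-Analysis.Analysis" "HOL-Library.Function_Algebras"
begin

section \<open>Complex vector spaces and complex Hilbert spaces\<close>

class complex_vector = ab_group_add +
  fixes scaleC :: "complex \<Rightarrow> 'a \<Rightarrow> 'a" (infixr "*\<^sub>C" 75)
  assumes scaleC_add_right: "a *\<^sub>C (x + y) = a *\<^sub>C x + a *\<^sub>C y"
    and scaleC_add_left: "(a + b) *\<^sub>C x = a *\<^sub>C x + b *\<^sub>C x"
    and scaleC_scaleC: "a *\<^sub>C (b *\<^sub>C x) = (a * b) *\<^sub>C x"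
    and scaleC_one: "1 *\<^sub>C x = x"

instantiation complex :: complex_vector
begin
definition scaleC_complex_def: "a *\<^sub>C (z :: complex) = a * z"
instance by standard (simp_all add: scaleC_complex_def algebra_simps)
end

instantiation "fun" :: (type, complex_vector) complex_vector
begin
definition scaleC_fun_def: "a *\<^sub>C f = (\<lambda>x. a *\<^sub>C f x)"
instance
  by standard
    (simp_all add: scaleC_fun_def fun_eq_iff scaleC_add_right scaleC_add_left scaleC_scaleC scaleC_one)
end

instantiation prod :: (complex_vector, complex_vector) complex_vector
begin
definition scaleC_prod_def: "a *\<^sub>C p = (a *\<^sub>C fst p, a *\<^sub>C snd p)"
instance
  by standard
    (simp_all add: scaleC_prod_def prod_eq_iff scaleC_add_right scaleC_add_left scaleC_scaleC scaleC_one)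
end

text \<open>The inner product is linear in the first and antilinear in the second argument.\<close>

class complex_inner = complex_vector + real_normed_vector +
  fixes cinner :: "'a \<Rightarrow> 'a \<Rightarrow> complex"
  assumes scaleR_scaleC: "r *\<^sub>R x = complex_of_real r *\<^sub>C x"
    and cinner_commute: "cinner x y = cnj (cinner y x)"
    and cinner_add_left: "cinner (x + y) z = cinner x z + cinner y z"
    and cinner_scaleC_left: "cinner (a *\<^sub>C x) y = a * cinner x y"
    and cinner_self: "cinner x x = complex_of_real ((norm x)\<^sup>2)"

class complex_hilbert = complex_inner + complete_space

instantiation complex :: complex_hilbert
begin
definition cinner_complex_def: "cinner (z :: complex) w = z * cnj w"
instance
proof
  fix r :: real and a x y z :: complex
  show "r *\<^sub>R x = complex_of_real r *\<^sub>C x"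
    by (simp add: scaleC_complex_def scaleR_conv_of_real)
  show "cinner x y = cnj (cinner y x)"
    by (simp add: cinner_complex_def)
  show "cinner (x + y) z = cinner x z + cinner y z"
    by (simp add: cinner_complex_def distrib_right)
  show "cinner (a *\<^sub>C x) y = a * cinner x y"
    by (simp add: cinner_complex_def scaleC_complex_def)
  show "cinner x x = complex_of_real ((norm x)\<^sup>2)"
    unfolding cinner_complex_def by (rule complex_norm_square [symmetric])
qed
end

definition csubspace :: "'a::complex_vector set \<Rightarrow> bool" where
  "csubspace S \<longleftrightarrow> 0 \<in> S \<and> (\<forall>x\<in>S. \<forall>y\<in>S. x + y \<in> S) \<and> (\<forall>c. \<forall>x\<in>S. c *\<^sub>C x \<in> S)"

definition clinear_on :: "'a::complex_vector set \<Rightarrow> ('a \<Rightarrow> 'b::complex_vector) \<Rightarrow> bool" where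
  "clinear_on S F \<longleftrightarrow> (\<forall>x\<in>S. \<forall>y\<in>S. F (x + y) = F x + F y) \<and> (\<forall>c. \<forall>x\<in>S. F (c *\<^sub>C x) = c *\<^sub>C F x)"


section \<open>Linear relations\<close>

text \<open>
  A linear relation from X to Y is a \<open>csubspace\<close> of \<open>X \<times> Y\<close>; operators are identified with their
  graphs.  The domain, range and inverse are the library's \<open>Domain\<close>, \<open>Range\<close> and \<open>converse\<close>.
\<close>

definition op_graph :: "'a set \<Rightarrow> ('a \<Rightarrow> 'b) \<Rightarrow> ('a \<times> 'b) set" where
  "op_graph D f = {(x, f x) | x. x \<in> D}"

definition restr :: "('a \<times> 'b) set \<Rightarrow> 'a set \<Rightarrow> ('a \<times> 'b) set" where
  "restr \<Theta> D = {(x, y) \<in> \<Theta>. x \<in> D}"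

definition rel_sum :: "('a \<times> 'b::complex_vector) set \<Rightarrow> ('a \<times> 'b) set \<Rightarrow> ('a \<times> 'b) set"
    (infixl "\<boxplus>" 65) where
  "\<Theta>1 \<boxplus> \<Theta>2 = {(x, x' + x'') | x x' x''. (x, x') \<in> \<Theta>1 \<and> (x, x'') \<in> \<Theta>2}"

definition rel_diff :: "('a \<times> 'b::complex_vector) set \<Rightarrow> ('a \<times> 'b) set \<Rightarrow> ('a \<times> 'b) set"
    (infixl "\<boxminus>" 65) where
  "\<Theta>1 \<boxminus> \<Theta>2 = {(x, x' - x'') | x x' x''. (x, x') \<in> \<Theta>1 \<and> (x, x'') \<in> \<Theta>2}"

text \<open>
  The product in operator order: \<open>\<Theta>2 \<odot> \<Theta>1\<close> applies \<open>\<Theta>1\<close> first, in contrast to \<open>relcomp\<close>.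
\<close>
abbreviation rel_prod :: "('b \<times> 'c) set \<Rightarrow> ('a \<times> 'b) set \<Rightarrow> ('a \<times> 'c) set"
    (infixr "\<odot>" 75) where
  "\<Theta>2 \<odot> \<Theta>1 \<equiv> \<Theta>1 O \<Theta>2"

definition rel_ker :: "('a \<times> 'b::zero) set \<Rightarrow> 'a set" where
  "rel_ker \<Theta> = {x. (x, 0) \<in> \<Theta>}"

definition scalar_rel :: "complex \<Rightarrow> ('a::complex_vector \<times> 'a) set" where
  "scalar_rel \<mu> = op_graph UNIV (\<lambda>x. \<mu> *\<^sub>C x)"

definition resolvent :: "('a::complex_vector \<times> 'a) set \<Rightarrow> complex \<Rightarrow> ('a \<times> 'a) set" where
  "resolvent \<Theta> \<mu> = (\<Theta> \<boxminus> scalar_rel \<mu>)\<inverse>"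

definition resolvent_set :: "('a::complex_hilbert \<times> 'a) set \<Rightarrow> complex set" where
  "resolvent_set \<Theta> = {\<mu>. single_valued (resolvent \<Theta> \<mu>) \<and> Domain (resolvent \<Theta> \<mu>) = UNIV
     \<and> (\<exists>C. \<forall>(x, y) \<in> resolvent \<Theta> \<mu>. norm y \<le> C * norm x)}"

definition point_spectrum :: "('a::complex_hilbert \<times> 'a) set \<Rightarrow> complex set" where
  "point_spectrum \<Theta> = {\<mu>. rel_ker (\<Theta> \<boxminus> scalar_rel \<mu>) \<noteq> {0}}"

definition continuous_spectrum :: "('a::complex_hilbert \<times> 'a) set \<Rightarrow> complex set" where
  "continuous_spectrum \<Theta> = {\<mu>. \<mu> \<notin> resolvent_set \<Theta> \<and> rel_ker (\<Theta> \<boxminus> scalar_rel \<mu>) = {0}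
     \<and> closure (Range (\<Theta> \<boxminus> scalar_rel \<mu>)) = UNIV}"

definition residual_spectrum :: "('a::complex_hilbert \<times> 'a) set \<Rightarrow> complex set" where
  "residual_spectrum \<Theta> = {\<mu>. rel_ker (\<Theta> \<boxminus> scalar_rel \<mu>) = {0}
     \<and> closure (Range (\<Theta> \<boxminus> scalar_rel \<mu>)) \<noteq> UNIV}"


section \<open>Operators in a Hilbert space and quasi boundary triples\<close>

definition lin_op :: "('h::complex_hilbert \<times> 'h) set \<Rightarrow> bool" where
  "lin_op S \<longleftrightarrow> csubspace S \<and> single_valued S"

definition densely_defined :: "('h::complex_hilbert \<times> 'h) set \<Rightarrow> bool" where
  "densely_defined S \<longleftrightarrow> closure (Domain S) = UNIV"

definition cadjoint :: "('h::complex_hilbert \<times> 'h) set \<Rightarrow> ('h \<times> 'h) set" where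
  "cadjoint S = {(g, g'). \<forall>(f, f') \<in> S. cinner f' g = cinner f g'}"

definition symmetric_op :: "('h::complex_hilbert \<times> 'h) set \<Rightarrow> bool" where
  "symmetric_op S \<longleftrightarrow> lin_op S \<and> densely_defined S \<and> S \<subseteq> cadjoint S"

definition selfadjoint_op :: "('h::complex_hilbert \<times> 'h) set \<Rightarrow> bool" where
  "selfadjoint_op S \<longleftrightarrow> lin_op S \<and> densely_defined S \<and> cadjoint S = S"

text \<open>Boundary maps are HOL functions of which only the values on \<open>Domain T\<close> matter.\<close>

definition ker_in :: "('h \<times> 'h) set \<Rightarrow> ('h \<Rightarrow> 'g::zero) \<Rightarrow> 'h set" where
  "ker_in T \<Gamma> = {f \<in> Domain T. \<Gamma> f = 0}"

definition quasi_boundary_triple ::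
  "('h::complex_hilbert \<times> 'h) set \<Rightarrow> ('h \<times> 'h) set
    \<Rightarrow> ('h \<Rightarrow> 'g::complex_hilbert) \<Rightarrow> ('h \<Rightarrow> 'g) \<Rightarrow> bool" where
  "quasi_boundary_triple A T \<Gamma>0 \<Gamma>1 \<longleftrightarrow>
     lin_op T \<and> T \<subseteq> cadjoint A \<and> closure T = cadjoint A
     \<and> clinear_on (Domain T) \<Gamma>0 \<and> clinear_on (Domain T) \<Gamma>1
     \<and> (\<forall>(f, Tf) \<in> T. \<forall>(g, Tg) \<in> T.
          cinner Tf g - cinner f Tg = cinner (\<Gamma>1 f) (\<Gamma>0 g) - cinner (\<Gamma>0 f) (\<Gamma>1 g))
     \<and> closure ((\<lambda>f. (\<Gamma>0 f, \<Gamma>1 f)) ` Domain T) = UNIV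
     \<and> selfadjoint_op (restr T (ker_in T \<Gamma>0))"


section \<open>Normed subspaces and their anti-duals\<close>

text \<open>
  A normed space is given by a carrier \<open>S\<close>, a subspace of an ambient complex vector space, and a
  function \<open>N\<close> whose values on \<open>S\<close> are the norm; it is unrelated to the ambient topology.
\<close>

definition norm_on :: "'a::complex_vector set \<Rightarrow> ('a \<Rightarrow> real) \<Rightarrow> bool" where
  "norm_on S N \<longleftrightarrow> csubspace S \<and> (\<forall>x\<in>S. 0 \<le> N x) \<and> (\<forall>x\<in>S. N x = 0 \<longleftrightarrow> x = 0)
     \<and> (\<forall>x\<in>S. \<forall>y\<in>S. N (x + y) \<le> N x + N y) \<and> (\<forall>c. \<forall>x\<in>S. N (c *\<^sub>C x) = cmod c * N x)"

definition complete_on :: "'a::complex_vector set \<Rightarrow> ('a \<Rightarrow> real) \<Rightarrow> bool" where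
  "complete_on S N \<longleftrightarrow>
     (\<forall>X :: nat \<Rightarrow> 'a. (\<forall>n. X n \<in> S) \<and> (\<forall>e>0. \<exists>K. \<forall>m\<ge>K. \<forall>n\<ge>K. N (X m - X n) < e)
        \<longrightarrow> (\<exists>x\<in>S. (\<lambda>n. N (X n - x)) \<longlonglongrightarrow> 0))"

text \<open>
  Continuous antilinear functionals on \<open>(S, N)\<close>; they are required to vanish off \<open>S\<close>, so that
  equality of functions is equality of functionals.  The pairing of \<open>\<phi>\<close> in the anti-dual with
  \<open>x \<in> S\<close> is \<open>\<phi> x\<close>, and the pairing of \<open>x\<close> with \<open>\<phi>\<close> is \<open>cnj (\<phi> x)\<close>.
\<close>
definition antidual :: "'a::complex_vector set \<Rightarrow> ('a \<Rightarrow> real) \<Rightarrow> ('a \<Rightarrow> complex) set" where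
  "antidual S N = {\<phi>. (\<forall>x\<in>S. \<forall>y\<in>S. \<phi> (x + y) = \<phi> x + \<phi> y)
     \<and> (\<forall>c. \<forall>x\<in>S. \<phi> (c *\<^sub>C x) = cnj c * \<phi> x)
     \<and> (\<exists>C. \<forall>x\<in>S. cmod (\<phi> x) \<le> C * N x)
     \<and> (\<forall>x. x \<notin> S \<longrightarrow> \<phi> x = 0)}"

definition antidual_norm :: "'a::complex_vector set \<Rightarrow> ('a \<Rightarrow> real) \<Rightarrow> ('a \<Rightarrow> complex) \<Rightarrow> real" where
  "antidual_norm S N \<phi> = (SUP x \<in> {x \<in> S. N x \<le> 1}. cmod (\<phi> x))"

text \<open>The canonical map into the anti-dual of the anti-dual sends \<open>x\<close> to \<open>\<phi> \<mapsto> cnj (\<phi> x)\<close>.\<close>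
definition reflexive_on :: "'a::complex_vector set \<Rightarrow> ('a \<Rightarrow> real) \<Rightarrow> bool" where
  "reflexive_on S N \<longleftrightarrow> (\<forall>F \<in> antidual (antidual S N) (antidual_norm S N).
     \<exists>x\<in>S. \<forall>\<phi> \<in> antidual S N. F \<phi> = cnj (\<phi> x))"

definition reflexive_banach_embedded :: "'g::complex_hilbert set \<Rightarrow> ('g \<Rightarrow> real) \<Rightarrow> bool" where
  "reflexive_banach_embedded S N \<longleftrightarrow> norm_on S N \<and> complete_on S N \<and> reflexive_on S N
     \<and> (\<exists>C. \<forall>x\<in>S. norm x \<le> C * N x)"

text \<open>
  With \<open>B\<close> a self-adjoint operator, \<open>\<Gamma> (B - cnj \<mu>)\<^sup>-\<^sup>1\<close> is continuous into a space with norm \<open>N\<close>.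
\<close>
definition continuous_after_resolvent ::
  "('h::complex_hilbert \<times> 'h) set \<Rightarrow> ('h \<Rightarrow> 'g) \<Rightarrow> ('g \<Rightarrow> real) \<Rightarrow> bool" where
  "continuous_after_resolvent B \<Gamma> N \<longleftrightarrow>
     (\<exists>\<mu> \<in> resolvent_set B. \<exists>C. \<forall>(h, f) \<in> resolvent B (cnj \<mu>). N (\<Gamma> f) \<le> C * norm h)"

text \<open>The embedding of the Hilbert space into the anti-dual of a subspace carrying its own norm.\<close>
definition embed :: "'g::complex_hilbert set \<Rightarrow> 'g \<Rightarrow> ('g \<Rightarrow> complex)" where
  "embed S g = (\<lambda>x. if x \<in> S then cinner g x else 0)"

definition isometric_identifications ::
  "'g::complex_hilbert set \<Rightarrow> ('g \<Rightarrow> real) \<Rightarrow> ('g \<Rightarrow> 'g) \<Rightarrow> (('g \<Rightarrow> complex) \<Rightarrow> 'g) \<Rightarrow> bool" where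
  "isometric_identifications S N \<iota>p \<iota>m \<longleftrightarrow>
     clinear_on S \<iota>p \<and> \<iota>p ` S = UNIV \<and> (\<forall>x\<in>S. norm (\<iota>p x) = N x)
     \<and> clinear_on (antidual S N) \<iota>m \<and> \<iota>m ` antidual S N = UNIV
     \<and> (\<forall>\<phi> \<in> antidual S N. norm (\<iota>m \<phi>) = antidual_norm S N \<phi>)
     \<and> (\<forall>x\<in>S. \<forall>\<phi> \<in> antidual S N. cinner (\<iota>m \<phi>) (\<iota>p x) = \<phi> x)"


section \<open>Extended boundary maps, gamma-field and Weyl function\<close>

text \<open>
  In this section \<open>B\<close> plays the role of the adjoint of \<open>A\<close>.  For \<open>(f, f') \<in> B\<close> the norm of the pair
  \<open>(f, f')\<close> in the product space is the graph norm of \<open>f\<close>.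
  Extended boundary maps vanish off \<open>Domain B\<close>, so that they are unique as functions.
\<close>

definition is_extended_boundary_map ::
  "('h::complex_hilbert \<times> 'h) set \<Rightarrow> ('h \<times> 'h) set \<Rightarrow> ('h \<Rightarrow> 'g::complex_hilbert)
    \<Rightarrow> 'g set \<Rightarrow> ('g \<Rightarrow> real) \<Rightarrow> ('h \<Rightarrow> 'g \<Rightarrow> complex) \<Rightarrow> bool" where
  "is_extended_boundary_map B T \<Gamma> S N E \<longleftrightarrow>
     E ` Domain B \<subseteq> antidual S N \<and> clinear_on (Domain B) E
     \<and> (\<forall>f \<in> Domain T. E f = embed S (\<Gamma> f))
     \<and> (\<exists>C. \<forall>(f, f') \<in> B. antidual_norm S N (E f) \<le> C * norm (f, f'))
     \<and> (\<forall>f. f \<notin> Domain B \<longrightarrow> E f = 0)"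

definition extended_boundary_map ::
  "('h::complex_hilbert \<times> 'h) set \<Rightarrow> ('h \<times> 'h) set \<Rightarrow> ('h \<Rightarrow> 'g::complex_hilbert)
    \<Rightarrow> 'g set \<Rightarrow> ('g \<Rightarrow> real) \<Rightarrow> ('h \<Rightarrow> 'g \<Rightarrow> complex)" where
  "extended_boundary_map B T \<Gamma> S N = (THE E. is_extended_boundary_map B T \<Gamma> S N E)"

definition extended_gamma ::
  "('h::complex_hilbert \<times> 'h) set \<Rightarrow> ('h \<Rightarrow> 'g \<Rightarrow> complex) \<Rightarrow> complex \<Rightarrow> ('g \<Rightarrow> complex) \<Rightarrow> 'h" where
  "extended_gamma B E0 \<mu> = the_inv_into (rel_ker (B \<boxminus> scalar_rel \<mu>)) E0"

definition extended_weyl ::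
  "('h::complex_hilbert \<times> 'h) set \<Rightarrow> ('h \<Rightarrow> 'g \<Rightarrow> complex) \<Rightarrow> ('h \<Rightarrow> 'g \<Rightarrow> complex)
    \<Rightarrow> complex \<Rightarrow> ('g \<Rightarrow> complex) \<Rightarrow> ('g \<Rightarrow> complex)" where
  "extended_weyl B E0 E1 \<mu> = E1 \<circ> extended_gamma B E0 \<mu>"

definition dual_map ::
  "'g::complex_hilbert set \<Rightarrow> ('g \<Rightarrow> real) \<Rightarrow> (('g \<Rightarrow> complex) \<Rightarrow> 'h::complex_hilbert) \<Rightarrow> 'h \<Rightarrow> 'g" where
  "dual_map S N \<gamma> h = (THE x. x \<in> S \<and> (\<forall>\<phi> \<in> antidual S N. cnj (\<phi> x) = cinner h (\<gamma> \<phi>)))"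

text \<open>
  \<open>\<Theta>\<close> takes its values in the anti-dual of \<open>S0\<close>.  When they lie in the copy of \<open>S1\<close> in that
  anti-dual, the following is \<open>\<Theta>\<close> read as a relation with values in \<open>S1\<close> itself.  The copy is
  faithful as long as \<open>S0\<close> is dense.
\<close>
definition values_in ::
  "'g::complex_hilbert set \<Rightarrow> 'g set \<Rightarrow> ('a \<times> ('g \<Rightarrow> complex)) set \<Rightarrow> ('a \<times> 'g) set" where
  "values_in S1 S0 \<Theta> = (op_graph S1 (embed S0))\<inverse> \<odot> \<Theta>"

definition boundary_extension ::
  "('h::complex_hilbert \<times> 'h) set \<Rightarrow> ('h \<Rightarrow> 'g \<Rightarrow> complex) \<Rightarrow> ('h \<Rightarrow> 'g \<Rightarrow> complex)
    \<Rightarrow> (('g \<Rightarrow> complex) \<times> ('g \<Rightarrow> complex)) set \<Rightarrow> ('h \<times> 'h) set" where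
  "boundary_extension B E0 E1 \<theta> = restr B {f \<in> Domain B. (E0 f, E1 f) \<in> \<theta>}"

end

theory Submission
  imports Defs
begin

text \<open>
  Everything rests on one decomposition.  Fix \<open>\<mu>\<close> in the resolvent set of \<open>A0\<close>, and let
  \<open>L \<mu> = \<Gamma>1 (A0 - \<mu>)\<^sup>-\<^sup>1\<close>.  The kernel of the extended map \<open>E0\<close> is the domain of \<open>A0\<close>, and \<open>\<gamma> \<mu> (E0 f)\<close> has
  the same value of \<open>E0\<close> as \<open>f\<close>.  Hence every \<open>f\<close> in the domain of the adjoint of \<open>A\<close> is
  \<open>(A0 - \<mu>)\<^sup>-\<^sup>1 h + \<gamma> \<mu> (E0 f)\<close>, where \<open>h\<close> is the image of \<open>f\<close> under the adjoint minus \<open>\<mu>\<close>.  Applying \<open>E1\<close>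
  gives \<open>E1 f = L \<mu> h + M \<mu> (E0 f)\<close>, so \<open>f\<close> satisfies the boundary condition \<open>\<theta>\<close> if and only if
  \<open>(E0 f, L \<mu> h)\<close> belongs to \<open>\<theta> - M \<mu>\<close>.  This is the identity
  \<open>(A\<theta> - \<mu>)\<^sup>-\<^sup>1 = (A0 - \<mu>)\<^sup>-\<^sup>1 + \<gamma> \<mu> (\<theta> - M \<mu>)\<^sup>-\<^sup>1 L \<mu>\<close> between linear relations, valid whether or not \<open>\<mu>\<close> is
  in the spectrum of \<open>A\<theta>\<close> (lemma \<open>boundary_extension_iff\<close>).  Since \<open>L \<mu>\<close> is the adjoint of
  \<open>\<gamma> (cnj \<mu>)\<close> (lemma \<open>dual_map_gamma\<close>), it contains the resolvent formula.

  The spectral equivalences are formal consequences (locale \<open>krein_link\<close>): \<open>\<gamma> \<mu>\<close> carries one kernel onto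
  the other, one range is the preimage of the other under \<open>L \<mu>\<close>, and a bounded inverse on one side
  yields one on the other.  For this \<open>\<gamma> \<mu>\<close> has to be bounded and bounded below, and \<open>L \<mu>\<close> has to be
  bounded and onto \<open>G1\<close> with a bounded right inverse; the two isometries move both to Hilbert spaces.

  The analysis behind this is elementary.  Green's identity prescribes the extended maps on the range of
  the other boundary map, and uniform boundedness makes them continuous in the graph norm
  (\<open>extended_boundary_map_characterization\<close>).  The Riesz representation of \<open>h \<mapsto> \<phi> (L (cnj \<mu>) h)\<close> is an
  element of \<open>ker (A* - \<mu>)\<close> that \<open>E0\<close> maps to \<open>\<phi>\<close>, which gives \<open>\<gamma> \<mu>\<close>.  The map \<open>\<gamma> \<mu>\<close> is bounded below since \<open>E0\<close> is
  bounded, and a preimage of \<open>x\<close> under \<open>L \<mu>\<close> of controlled norm is found in the range of \<open>\<gamma> (cnj \<mu>)\<close>.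
\<close>

section \<open>Complex inner product spaces\<close>

interpretation complex_vector: vector_space scaleC
  by unfold_locales (simp_all add: scaleC_add_right scaleC_add_left scaleC_scaleC scaleC_one)

lemma csubspace_diff: "csubspace S \<Longrightarrow> x \<in> S \<Longrightarrow> y \<in> S \<Longrightarrow> x - y \<in> S"
  unfolding csubspace_def
  by (metis complex_vector.scale_minus_left complex_vector.scale_one uminus_add_conv_diff add.commute)

lemma csubspace_add: "csubspace S \<Longrightarrow> x \<in> S \<Longrightarrow> y \<in> S \<Longrightarrow> x + y \<in> S"
  and csubspace_scaleC: "csubspace S \<Longrightarrow> x \<in> S \<Longrightarrow> c *\<^sub>C x \<in> S"
  and csubspace_0: "csubspace S \<Longrightarrow> 0 \<in> S"
  unfolding csubspace_def by auto

lemma csubspace_UNIV: "csubspace UNIV"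
  by (simp add: csubspace_def)

lemma clinear_on_diff:
  assumes "clinear_on S F" "csubspace S" "x \<in> S" "y \<in> S"
  shows "F (x - y) = F x - F y"
  using assms csubspace_diff[of S x y] unfolding clinear_on_def
  by (metis add_diff_cancel_right' diff_add_cancel)

lemma cinner_add_right: "cinner x (y + z) = cinner x y + cinner x z"
  by (metis cinner_add_left cinner_commute complex_cnj_add)

lemma cinner_scaleC_right: "cinner x (a *\<^sub>C y) = cnj a * cinner x y"
  by (metis cinner_scaleC_left cinner_commute complex_cnj_mult)

lemma cinner_diff_left: "cinner (x - y) z = cinner x z - cinner y z"
  by (metis add_diff_cancel_right' cinner_add_left diff_add_cancel)

lemma cinner_diff_right: "cinner x (y - z) = cinner x y - cinner x z"
  by (metis add_diff_cancel_right' cinner_add_right diff_add_cancel)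

lemma cinner_zero_left [simp]: "cinner 0 x = 0"
  by (metis cinner_diff_left diff_self)

lemma cinner_zero_right [simp]: "cinner x 0 = 0"
  by (metis cinner_diff_right diff_self)

lemmas cinner_linear = cinner_add_left cinner_add_right cinner_diff_left cinner_diff_right
  cinner_scaleC_left cinner_scaleC_right

lemma Re_cinner_self: "Re (cinner x x) = (norm x)\<^sup>2"
  by (simp add: cinner_self)

lemma norm_diff_square:
  "(norm (x - y))\<^sup>2 = (norm x)\<^sup>2 + (norm y)\<^sup>2 - 2 * Re (cinner x y)"
proof -
  have "Re (cinner y x) = Re (cinner x y)" by (metis cinner_commute cnj.sel(1))
  then show ?thesis
    by (simp add: Re_cinner_self[symmetric] cinner_linear)
qed

lemma norm_add_square:
  "(norm (x + y))\<^sup>2 = (norm x)\<^sup>2 + (norm y)\<^sup>2 + 2 * Re (cinner x y)"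
proof -
  have "Re (cinner y x) = Re (cinner x y)" by (metis cinner_commute cnj.sel(1))
  then show ?thesis
    by (simp add: Re_cinner_self[symmetric] cinner_linear)
qed

lemma norm_scaleC: "norm (a *\<^sub>C x) = cmod a * norm (x::'a::complex_inner)"
proof -
  have "complex_of_real ((norm (a *\<^sub>C x))\<^sup>2) = a * cnj a * cinner x x"
    by (simp add: cinner_self[symmetric] cinner_linear del: of_real_power)
  also have "\<dots> = complex_of_real ((cmod a * norm x)\<^sup>2)"
    by (simp add: cinner_self complex_norm_square[symmetric] power_mult_distrib)
  finally have "(norm (a *\<^sub>C x))\<^sup>2 = (cmod a * norm x)\<^sup>2"
    using of_real_eq_iff by blast
  then show ?thesis by simp
qed

lemma cinner_cauchy_schwarz: "cmod (cinner x y) \<le> norm x * norm y"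
proof (cases "y = 0")
  case False
  define c where "c = cinner x y / complex_of_real ((norm y)\<^sup>2)"
  have n: "(norm y)\<^sup>2 > 0" using False by simp
  have "0 \<le> (norm (x - c *\<^sub>C y))\<^sup>2" by simp
  also have "\<dots> = (norm x)\<^sup>2 + (cmod c * norm y)\<^sup>2 - 2 * Re (cnj c * cinner x y)"
    by (simp add: norm_diff_square cinner_linear norm_scaleC)
  also have "cnj c * cinner x y = complex_of_real ((cmod (cinner x y))\<^sup>2 / (norm y)\<^sup>2)"
    by (simp add: c_def mult.commute[of "cnj _"] complex_norm_square[symmetric] del: of_real_power)
  also have "Re \<dots> = (cmod (cinner x y))\<^sup>2 / (norm y)\<^sup>2" by simp
  also have "(cmod c * norm y)\<^sup>2 = (cmod (cinner x y))\<^sup>2 / (norm y)\<^sup>2"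
    using n by (simp add: c_def norm_divide norm_power power_mult_distrib power_divide field_simps power2_eq_square del: of_real_mult)
  finally have "(cmod (cinner x y))\<^sup>2 / (norm y)\<^sup>2 \<le> (norm x)\<^sup>2" by simp
  then have "(cmod (cinner x y))\<^sup>2 \<le> (norm x * norm y)\<^sup>2"
    using n by (simp add: pos_divide_le_eq power_mult_distrib)
  then show ?thesis by (rule power2_le_imp_le) simp
qed simp

lemma bounded_linear_cinner_left: "bounded_linear (\<lambda>x. cinner x y)"
  by (rule bounded_linear_intro[where K="norm y"])
    (simp_all add: cinner_linear scaleR_scaleC scaleC_complex_def cinner_cauchy_schwarz)

lemma bounded_linear_cinner_right: "bounded_linear (\<lambda>y. cinner x y)"
  by (rule bounded_linear_intro[where K="norm x"])
    (simp_all add: cinner_linear scaleR_scaleC scaleC_complex_def cinner_cauchy_schwarz mult.commute[of _ "norm x"])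

lemmas continuous_on_cinner_left [continuous_intros] =
  bounded_linear.continuous_on[OF bounded_linear_cinner_left]
lemmas continuous_on_cinner_right [continuous_intros] =
  bounded_linear.continuous_on[OF bounded_linear_cinner_right]

lemma dense_separates_left:
  assumes "closure D = UNIV" and "\<And>x. x \<in> D \<Longrightarrow> cinner a x = cinner b x"
  shows "a = b"
proof -
  have "closed {x. cinner a x = cinner b x}"
    by (intro closed_Collect_eq continuous_intros)
  then have "cinner a (a - b) = cinner b (a - b)"
    using closure_minimal[of D "{x. cinner a x = cinner b x}"] assms by auto
  then have "cinner (a - b) (a - b) = 0" by (simp add: cinner_diff_left)
  then show ?thesis by (simp add: cinner_self)
qed

lemma dense_separates_right:
  assumes "closure D = UNIV" and "\<And>x. x \<in> D \<Longrightarrow> cinner x a = cinner x b"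
  shows "a = b"
  using assms by (intro dense_separates_left[of D a b]) (metis cinner_commute)+

text \<open>
  The representing vector minimizes \<open>\<parallel>v\<parallel>\<^sup>2 - 2 Re (\<phi> v)\<close> over \<open>V\<close>: a minimizing sequence is Cauchy by
  the parallelogram law, and the first variation at the limit vanishes.  Allowing a closed subspace
  covers orthogonal projection as well, by taking \<open>\<phi> = cinner h\<close>.
\<close>

theorem riesz_representation:
  fixes V :: "'a::complex_hilbert set" and \<phi> :: "'a \<Rightarrow> complex"
  assumes V: "csubspace V" "closed V"
    and add: "\<And>x y. x \<in> V \<Longrightarrow> y \<in> V \<Longrightarrow> \<phi> (x + y) = \<phi> x + \<phi> y"
    and scale: "\<And>c x. x \<in> V \<Longrightarrow> \<phi> (c *\<^sub>C x) = cnj c * \<phi> x"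
    and bound: "\<And>x. x \<in> V \<Longrightarrow> cmod (\<phi> x) \<le> C * norm x"
  shows "\<exists>v\<in>V. \<forall>h\<in>V. \<phi> h = cinner v h"
proof -
  define J where "J v = (norm v)\<^sup>2 - 2 * Re (\<phi> v)" for v
  define m where "m = Inf (J ` V)"
  have V_mem: "x + y \<in> V" "c *\<^sub>C x \<in> V" "x - y \<in> V" "0 \<in> V" if "x \<in> V" "y \<in> V" for x y c
    using V that by (auto simp: csubspace_diff csubspace_add csubspace_scaleC csubspace_0)
  have zero: "0 \<in> V" using V by (simp add: csubspace_0)
  have "- (C\<^sup>2) \<le> J v" if "v \<in> V" for v
  proof -
    have "Re (\<phi> v) \<le> C * norm v" using bound[OF that] complex_Re_le_cmod order_trans by blast
    moreover have "0 \<le> (norm v - C)\<^sup>2" by simp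
    ultimately show ?thesis unfolding J_def power2_diff by (simp add: mult.commute)
  qed
  then have bdd: "bdd_below (J ` V)" by (rule bdd_belowI2)
  have m_le: "m \<le> J v" if "v \<in> V" for v
    unfolding m_def using bdd that by (rule cINF_lower)
  have "\<exists>v\<in>V. J v < m + 1 / real (Suc n)" for n
    using cINF_less_iff[OF _ bdd, of "m + 1 / real (Suc n)"] zero unfolding m_def by auto
  then obtain v where v: "\<And>n. v n \<in> V" "\<And>n. J (v n) < m + 1 / real (Suc n)"
    by metis
  (* The midpoint of x and y lies in V, so J is at least m there; the parallelogram law turns this
     into a bound on the distance of x and y. *)
  have par: "(norm (x - y))\<^sup>2 \<le> 2 * J x + 2 * J y - 4 * m" if "x \<in> V" "y \<in> V" for x y
  proof -
    define z where "z = (1/2::complex) *\<^sub>C (x + y)"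
    have z: "z \<in> V" using that V_mem by (auto simp: z_def)
    have "(norm z)\<^sup>2 = (norm (x + y))\<^sup>2 / 4"
      by (simp add: z_def norm_scaleC power_divide norm_divide)
    moreover have "\<phi> z = (\<phi> x + \<phi> y) / 2"
      using that V_mem by (simp add: z_def scale add)
    moreover have "Re ((\<phi> x + \<phi> y) / 2) = (Re (\<phi> x) + Re (\<phi> y)) / 2" by simp
    ultimately have "4 * J z = (norm (x + y))\<^sup>2 - 4 * Re (\<phi> x) - 4 * Re (\<phi> y)"
      unfolding J_def by (simp only:) (simp add: field_simps)
    then show ?thesis
      using m_le[OF z] unfolding J_def norm_add_square norm_diff_square by simp
  qed
  have "Cauchy v"
  proof (rule CauchyI)
    fix e :: real assume e: "0 < e"
    obtain K :: nat where K: "4 / e\<^sup>2 < real K" using reals_Archimedean2 by blast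
    have Kpos: "0 < real K" using K e by (meson divide_pos_pos less_trans zero_less_numeral zero_less_power)
    have "norm (v i - v j) < e" if "K \<le> i" "K \<le> j" for i j
    proof -
      have "1 / real (Suc i) \<le> 1 / real K" "1 / real (Suc j) \<le> 1 / real K"
        using that Kpos by (auto intro!: divide_left_mono)
      then have "(norm (v i - v j))\<^sup>2 < 4 / real K"
        using par[OF v(1)[of i] v(1)[of j]] v(2)[of i] v(2)[of j] by simp
      also have "\<dots> < e\<^sup>2" using K Kpos e by (simp add: field_simps)
      finally show ?thesis using e by (simp add: power2_less_imp_less)
    qed
    then show "\<exists>M. \<forall>m\<ge>M. \<forall>n\<ge>M. norm (v m - v n) < e" by blast
  qed
  then obtain w where lim: "v \<longlonglongrightarrow> w" by (meson Cauchy_convergent convergent_def)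
  then have w: "w \<in> V" using V(2) v(1) closed_sequentially by blast
  have phi_diff: "\<phi> (x - y) = \<phi> x - \<phi> y" if "x \<in> V" "y \<in> V" for x y
    using add[of "x - y" y] V_mem that by simp
  have "(\<lambda>n. \<phi> (v n)) \<longlonglongrightarrow> \<phi> w"
  proof (rule Lim_null_comparison[THEN Lim_null[THEN iffD2]])
    show "\<forall>\<^sub>F n in sequentially. norm (\<phi> (v n) - \<phi> w) \<le> C * norm (v n - w)"
      using bound v(1) w V_mem by (simp flip: phi_diff)
    show "(\<lambda>n. C * norm (v n - w)) \<longlonglongrightarrow> 0"
      using lim by (intro tendsto_mult_right_zero) (simp add: tendsto_norm_zero LIM_zero)
  qed
  then have "(\<lambda>n. J (v n)) \<longlonglongrightarrow> J w"
    unfolding J_def using lim by (intro tendsto_intros)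
  moreover have "(\<lambda>n. m + 1 / real (Suc n)) \<longlonglongrightarrow> m + 0"
    by (intro tendsto_intros LIMSEQ_Suc[OF lim_1_over_n])
  ultimately have Jw: "J w \<le> m"
    using LIMSEQ_le[of "\<lambda>n. J (v n)" "J w" "\<lambda>n. m + 1 / real (Suc n)" "m + 0"] v(2) less_imp_le
    by (metis add.right_neutral)
  have re: "Re (\<phi> h) = Re (cinner w h)" if h: "h \<in> V" for h
  proof (rule ccontr)
    define d where "d = Re (\<phi> h) - Re (cinner w h)"
    assume "Re (\<phi> h) \<noteq> Re (cinner w h)"
    then have d: "d \<noteq> 0" by (simp add: d_def)
    define N where "N = (norm h)\<^sup>2 + 1"
    have N: "N > 0" by (simp add: N_def add_nonneg_pos)
    (* Close to the minimizer of J (w + t h) in t; the summand 1 in N avoids the case h = 0. *)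
    define t where "t = d / N"
    have "J (w + complex_of_real t *\<^sub>C h) = J w - 2 * t * d + t\<^sup>2 * (norm h)\<^sup>2"
      using w h V_mem
      by (simp add: J_def norm_add_square cinner_linear add scale norm_scaleC d_def algebra_simps)
    also have "\<dots> < J w - 2 * t * d + t\<^sup>2 * N"
      using d N by (simp add: N_def t_def)
    also have "\<dots> = J w - d\<^sup>2 / N" using N by (simp add: t_def power2_eq_square field_simps)
    also have "\<dots> \<le> m" using Jw N by (smt (verit) divide_nonneg_pos zero_le_power2)
    finally show False using m_le[of "w + complex_of_real t *\<^sub>C h"] w h V_mem by force
  qed
  (* The imaginary part at h is the real part at i h, because both sides are antilinear. *)
  have "\<phi> h = cinner w h" if h: "h \<in> V" for h
  proof (rule complex_eqI)
    have "Re (\<phi> (\<i> *\<^sub>C h)) = Re (cinner w (\<i> *\<^sub>C h))" using re V_mem h by blast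
    then show "Im (\<phi> h) = Im (cinner w h)" by (simp add: scale h cinner_linear)
  qed (simp add: re h)
  then show ?thesis using w by blast
qed

section \<open>Normed subspaces\<close>

text \<open>
  If no uniform bound exists, then for each \<open>n\<close> the set of \<open>x\<close> at which some functional exceeds \<open>n\<close>
  is open and dense, and by Baire's theorem some \<open>x\<close> lies in all of these sets, against pointwise
  boundedness.  The norm \<open>N\<close> has nothing to do with the type's own topology, so the carrier is turned
  into a metric space of its own.
\<close>

theorem uniform_boundedness:
  fixes S :: "'a::complex_vector set"
  assumes norm: "norm_on S N" and complete: "complete_on S N"
    and add: "\<And>\<phi> x y. \<phi> \<in> F \<Longrightarrow> x \<in> S \<Longrightarrow> y \<in> S \<Longrightarrow> \<phi> (x + y) = \<phi> x + \<phi> y"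
    and scale: "\<And>\<phi> c x. \<phi> \<in> F \<Longrightarrow> x \<in> S \<Longrightarrow> \<phi> (c *\<^sub>C x) = cnj c * \<phi> x"
    and bounded: "\<And>\<phi>. \<phi> \<in> F \<Longrightarrow> \<exists>C. \<forall>x\<in>S. cmod (\<phi> x) \<le> C * N x"
    and pointwise: "\<And>x. x \<in> S \<Longrightarrow> \<exists>K. \<forall>\<phi>\<in>F. cmod (\<phi> x) \<le> K"
  shows "\<exists>C\<ge>0. \<forall>\<phi>\<in>F. \<forall>x\<in>S. cmod (\<phi> x) \<le> C * N x"
proof (rule ccontr)
  assume unb: "\<not> ?thesis"
  have S: "csubspace S" and N_nonneg: "\<And>x. x \<in> S \<Longrightarrow> 0 \<le> N x"
    and N_zero: "\<And>x. x \<in> S \<Longrightarrow> N x = 0 \<longleftrightarrow> x = 0"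
    and N_tri: "\<And>x y. x \<in> S \<Longrightarrow> y \<in> S \<Longrightarrow> N (x + y) \<le> N x + N y"
    and N_scale: "\<And>c x. x \<in> S \<Longrightarrow> N (c *\<^sub>C x) = cmod c * N x"
    using norm by (simp_all add: norm_on_def)
  note mem = csubspace_diff[OF S] csubspace_add[OF S] csubspace_scaleC[OF S]
  (* Metric_space asks for symmetry and positivity of the metric off the carrier too. *)
  define d where "d x y = (if x \<in> S \<and> y \<in> S then N (x - y) else 0)" for x y
  have N_minus: "N (- x) = N x" if "x \<in> S" for x
    using N_scale[OF that, of "-1"] by simp
  interpret Metric_space S d
  proof
    fix x y z
    show "0 \<le> d x y" by (simp add: d_def N_nonneg mem)
    show "d x y = d y x" using N_minus[of "x - y"] by (simp add: d_def mem)
    show "x \<in> S \<Longrightarrow> y \<in> S \<Longrightarrow> (d x y = 0) = (x = y)" by (simp add: d_def N_zero mem)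
    show "x \<in> S \<Longrightarrow> y \<in> S \<Longrightarrow> z \<in> S \<Longrightarrow> d x z \<le> d x y + d y z"
      using N_tri[of "x - y" "y - z"] by (simp add: d_def mem)
  qed
  have mcomplete: mcomplete
    unfolding mcomplete_def
  proof (intro allI impI)
    fix X assume X: "MCauchy X"
    have "\<exists>x\<in>S. (\<lambda>n. N (X n - x)) \<longlonglongrightarrow> 0"
    proof (rule complete[unfolded complete_on_def, rule_format], intro conjI allI impI)
      show "X n \<in> S" for n using X by (auto simp: MCauchy_def)
      fix e :: real assume "0 < e"
      then obtain K where "\<forall>n n'. K \<le> n \<longrightarrow> K \<le> n' \<longrightarrow> d (X n) (X n') < e"
        using X unfolding MCauchy_def by blast
      then show "\<exists>K. \<forall>m\<ge>K. \<forall>n\<ge>K. N (X m - X n) < e"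
        using X by (intro exI[of _ K]) (auto simp: MCauchy_def d_def image_subset_iff)
    qed
    then obtain x where x: "x \<in> S" "(\<lambda>n. N (X n - x)) \<longlonglongrightarrow> 0" by blast
    have "(\<lambda>n. d (X n) x) \<longlonglongrightarrow> 0"
      using x X by (simp add: d_def MCauchy_def image_subset_iff)
    then show "\<exists>x. limitin mtopology X x sequentially"
      using x X unfolding limitin_metric_dist_null MCauchy_def
      by (intro exI[of _ x]) (auto simp: image_subset_iff)
  qed
  define U where "U n = {x \<in> S. \<exists>\<phi>\<in>F. real n < cmod (\<phi> x)}" for n :: nat
  have phi_diff: "\<phi> (x - y) = \<phi> x - \<phi> y" if "\<phi> \<in> F" "x \<in> S" "y \<in> S" for \<phi> x y
    using add[of \<phi> "x - y" y] that by (simp add: mem)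
  have U_open: "openin mtopology (U n)" for n
    unfolding openin_mtopology
  proof (intro conjI allI impI)
    show "U n \<subseteq> S" by (auto simp: U_def)
    fix x assume "x \<in> U n"
    then obtain \<phi> where p: "x \<in> S" "\<phi> \<in> F" "real n < cmod (\<phi> x)" by (auto simp: U_def)
    obtain C where C: "\<And>y. y \<in> S \<Longrightarrow> cmod (\<phi> y) \<le> C * N y" using bounded p(2) by blast
    define r where "r = (cmod (\<phi> x) - n) / (\<bar>C\<bar> + 1)"
    have r: "r > 0" using p by (simp add: r_def)
    have "y \<in> U n" if "y \<in> mball x r" for y
    proof -
      have y: "y \<in> S" "N (x - y) < r" using that p by (auto simp: d_def)
      have "cmod (\<phi> x) - cmod (\<phi> y) \<le> cmod (\<phi> (x - y))"
        using y p by (simp add: phi_diff norm_triangle_ineq2)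
      also have "\<dots> \<le> C * N (x - y)" using C y p mem by blast
      also have "\<dots> \<le> (\<bar>C\<bar> + 1) * N (x - y)"
        using N_nonneg[of "x - y"] y p mem by (intro mult_right_mono) auto
      also have "\<dots> < (\<bar>C\<bar> + 1) * r" using y by (intro mult_strict_left_mono) auto
      also have "\<dots> = cmod (\<phi> x) - n" by (simp add: r_def)
      finally show ?thesis using p y by (auto simp: U_def)
    qed
    then show "\<exists>r>0. mball x r \<subseteq> U n" using r by blast
  qed
  have U_dense: "mtopology closure_of (U n) = S" for n
  proof -
    have "\<exists>z\<in>U n. z \<in> mball x r" if x: "x \<in> S" and r: "r > 0" for x r
    proof -
      define C where "C = (2 * n + 2) / r"
      have "C \<ge> 0" using r by (simp add: C_def)
      then obtain \<phi> y where y: "\<phi> \<in> F" "y \<in> S" "cmod (\<phi> y) > C * N y"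
        using unb by (meson not_le)
      have "N y \<noteq> 0"
        using y scale[of \<phi> 0 0] N_zero[of y] by (auto simp: csubspace_0[OF S])
      then have Ny: "N y > 0" using N_nonneg[of y] y by simp
      define u where "u = complex_of_real (r / (2 * N y)) *\<^sub>C y"
      have u: "u \<in> S" "N u = r / 2"
        using y Ny r mem by (auto simp: u_def N_scale norm_divide norm_mult)
      have "cmod (\<phi> u) = r / (2 * N y) * cmod (\<phi> y)"
        using y Ny r by (simp add: u_def scale norm_divide norm_mult)
      also have "\<dots> > r / (2 * N y) * (C * N y)"
        using y Ny r by (intro mult_strict_left_mono) auto
      also have "r / (2 * N y) * (C * N y) = real n + 1" using r Ny by (simp add: C_def field_simps)
      finally have big: "cmod (\<phi> u) > real n + 1" .
      (* One of x + u and x - u carries at least the value of u. *)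
      have "\<phi> (x + u) - \<phi> (x - u) = 2 * \<phi> u" using x u y by (simp add: add phi_diff)
      then have "2 * cmod (\<phi> u) \<le> cmod (\<phi> (x + u)) + cmod (\<phi> (x - u))"
        by (metis norm_mult norm_numeral norm_triangle_ineq4)
      then have "x + u \<in> U n \<or> x - u \<in> U n"
        using big y x u mem unfolding U_def by force
      moreover have "x + u \<in> mball x r" "x - u \<in> mball x r"
        using x u r mem N_minus[of u] by (auto simp: d_def)
      ultimately show ?thesis by blast
    qed
    then show ?thesis unfolding metric_closure_of by (auto simp: U_def)
  qed
  have "mtopology closure_of \<Inter>(range U) = S"
    using mcomplete U_open U_dense by (intro metric_Baire_category) auto
  moreover have "S \<noteq> {}" using S by (auto simp: csubspace_def)
  ultimately obtain x where x: "\<And>n. x \<in> U n"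
    by (metis INT_E UNIV_I closure_of_empty equals0I)
  then obtain K where "\<And>\<phi>. \<phi> \<in> F \<Longrightarrow> cmod (\<phi> x) \<le> K" using pointwise[of x] by (auto simp: U_def)
  moreover obtain n :: nat where "K < n" using reals_Archimedean2 by blast
  ultimately show False using x[of n] by (force simp: U_def)
qed

lemma antidual_bdd_above:
  assumes norm: "norm_on S N" and phi: "\<phi> \<in> antidual S N"
  shows "bdd_above ((\<lambda>x. cmod (\<phi> x)) ` {x \<in> S. N x \<le> 1})"
proof -
  obtain C where C: "\<And>y. y \<in> S \<Longrightarrow> cmod (\<phi> y) \<le> C * N y" using phi unfolding antidual_def by blast
  have "cmod (\<phi> y) \<le> \<bar>C\<bar>" if "y \<in> S" "N y \<le> 1" for y
  proof -
    have "0 \<le> N y" using norm that by (simp add: norm_on_def)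
    then have "C * N y \<le> \<bar>C\<bar> * 1" using that by (intro mult_mono) auto
    then show ?thesis using C[OF that(1)] by simp
  qed
  then show ?thesis by (intro bdd_aboveI2) auto
qed

lemma antidual_norm_nonneg:
  assumes norm: "norm_on S N" and phi: "\<phi> \<in> antidual S N"
  shows "0 \<le> antidual_norm S N \<phi>"
proof -
  have "0 \<in> S" "N 0 = 0" using norm by (simp_all add: norm_on_def csubspace_def)
  then have "cmod (\<phi> 0) \<le> antidual_norm S N \<phi>"
    unfolding antidual_norm_def by (intro cSUP_upper antidual_bdd_above[OF norm phi]) simp
  then show ?thesis by (rule order_trans[OF norm_ge_zero])
qed

lemma antidual_bound:
  assumes norm: "norm_on S N" and phi: "\<phi> \<in> antidual S N" and x: "x \<in> S"
  shows "cmod (\<phi> x) \<le> antidual_norm S N \<phi> * N x"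
proof (cases "x = 0")
  case True
  have "\<phi> (0 *\<^sub>C x) = cnj 0 * \<phi> x" using phi x unfolding antidual_def by blast
  moreover have "N x = 0" using norm x True by (simp add: norm_on_def)
  ultimately show ?thesis using True by simp
next
  case False
  have "N x \<noteq> 0" "N x \<ge> 0" using norm x False by (simp_all add: norm_on_def)
  then have Nx: "N x > 0" by simp
  note bdd = antidual_bdd_above[OF norm phi]
  define u where "u = complex_of_real (1 / N x) *\<^sub>C x"
  have "N u = cmod (complex_of_real (1 / N x)) * N x" "u \<in> S"
    using norm x by (simp_all add: norm_on_def csubspace_def u_def)
  then have "u \<in> {y \<in> S. N y \<le> 1}" using Nx by (simp add: norm_divide)
  then have "cmod (\<phi> u) \<le> antidual_norm S N \<phi>"
    unfolding antidual_norm_def by (intro cSUP_upper bdd)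
  moreover have "\<phi> u = complex_of_real (1 / N x) * \<phi> x"
    using phi x unfolding antidual_def u_def by simp
  ultimately show ?thesis using Nx by (simp add: norm_mult norm_divide pos_divide_le_eq)
qed

lemma antidual_norm_le:
  assumes norm: "norm_on S N" and C: "C \<ge> 0" "\<And>x. x \<in> S \<Longrightarrow> cmod (\<phi> x) \<le> C * N x"
  shows "antidual_norm S N \<phi> \<le> C"
  unfolding antidual_norm_def
proof (rule cSUP_least)
  have "0 \<in> S" "N 0 = 0" using norm by (simp_all add: norm_on_def csubspace_def)
  then show "{x \<in> S. N x \<le> 1} \<noteq> {}" by auto
  fix x assume x: "x \<in> {x \<in> S. N x \<le> 1}"
  then have "C * N x \<le> C * 1" using C by (intro mult_left_mono) auto
  then show "cmod (\<phi> x) \<le> C" using C(2)[of x] x by simp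
qed

lemma antidualD:
  assumes "\<phi> \<in> antidual S N"
  shows "x \<in> S \<Longrightarrow> y \<in> S \<Longrightarrow> \<phi> (x + y) = \<phi> x + \<phi> y"
    and "x \<in> S \<Longrightarrow> \<phi> (c *\<^sub>C x) = cnj c * \<phi> x"
    and "x \<notin> S \<Longrightarrow> \<phi> x = 0"
  using assms unfolding antidual_def by blast+

lemma antidual_ext:
  assumes "\<phi> \<in> antidual S N" "\<psi> \<in> antidual S N" "\<And>x. x \<in> S \<Longrightarrow> \<phi> x = \<psi> x"
  shows "\<phi> = \<psi>"
  using assms antidualD(3) by (metis ext)

lemma embed_in_antidual:
  assumes S: "csubspace S" and C: "\<And>x. x \<in> S \<Longrightarrow> norm x \<le> C * N x"
  shows "embed S g \<in> antidual S N"
proof -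
  have "cmod (cinner g x) \<le> (norm g * C) * N x" if "x \<in> S" for x
  proof -
    have "cmod (cinner g x) \<le> norm g * norm x" by (rule cinner_cauchy_schwarz)
    also have "\<dots> \<le> norm g * (C * N x)" using C[OF that] by (rule mult_left_mono) simp
    finally show ?thesis by (simp add: mult.assoc)
  qed
  then show ?thesis
    using csubspace_add[OF S] csubspace_scaleC[OF S]
    by (auto simp: antidual_def embed_def cinner_linear)
qed

lemma csubspace_Domain:
  assumes "csubspace B"
  shows "csubspace (Domain B)"
  unfolding csubspace_def
proof (intro conjI ballI allI)
  show "0 \<in> Domain B" using csubspace_0[OF assms] by (auto simp: zero_prod_def)
  show "x + y \<in> Domain B" if "x \<in> Domain B" "y \<in> Domain B" for x y
    using that csubspace_add[OF assms] by fastforce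
  show "c *\<^sub>C x \<in> Domain B" if "x \<in> Domain B" for c x
    using that csubspace_scaleC[OF assms, of _ c] by (fastforce simp: scaleC_prod_def)
qed

section \<open>Continuous extension of boundary maps\<close>

text \<open>
  Both boundary maps are treated at once: \<open>\<Gamma>\<close> is the map to be extended, \<open>K\<close> is its kernel, \<open>\<Lambda>\<close> is the
  other boundary map, and \<open>s\<close> is the sign in Green's identity: \<open>-1\<close> for \<open>\<Gamma>0\<close> and \<open>1\<close> for \<open>\<Gamma>1\<close>.  The two
  sides of the conclusion are continuous in the graph norm and agree on \<open>T\<close>, hence on its closure.
\<close>

lemma extended_boundary_map_pairing:
  fixes B T :: "('h::complex_hilbert \<times> 'h) set" and \<Gamma> \<Lambda> :: "'h \<Rightarrow> 'g::complex_hilbert"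
  assumes B: "csubspace B" "closure T = B" and norm: "norm_on S N" and S: "S = \<Lambda> ` K"
    and green: "\<And>f f' g g'. (f, f') \<in> T \<Longrightarrow> (g, g') \<in> T \<Longrightarrow> g \<in> K
      \<Longrightarrow> cinner (\<Gamma> f) (\<Lambda> g) = s * (cinner f' g - cinner f g')"
    and E: "is_extended_boundary_map B T \<Gamma> S N E"
    and f: "(f, f') \<in> B" and g: "(g, g') \<in> T" "g \<in> K"
  shows "E f (\<Lambda> g) = s * (cinner f' g - cinner f g')"
proof -
  obtain p where p: "\<And>n. p n \<in> T" "p \<longlonglongrightarrow> (f, f')"
    using f unfolding B(2)[symmetric] closure_sequential by blast
  define x where "x = \<Lambda> g"
  have x: "x \<in> S" using S g x_def by blast
  have TB: "T \<subseteq> B" using B(2) closure_subset by blast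
  obtain C where C: "\<And>h h'. (h, h') \<in> B \<Longrightarrow> antidual_norm S N (E h) \<le> C * norm (h, h')"
    using E unfolding is_extended_boundary_map_def by blast
  have mem: "E h \<in> antidual S N" if "h \<in> Domain B" for h
    using E that unfolding is_extended_boundary_map_def by blast
  have lin: "E (h - k) = E h - E k" if "h \<in> Domain B" "k \<in> Domain B" for h k
  proof (rule clinear_on_diff)
    show "clinear_on (Domain B) E" using E unfolding is_extended_boundary_map_def by blast
    show "csubspace (Domain B)" using B(1) by (rule csubspace_Domain)
  qed (use that in auto)
  have E_T: "E (fst q) x = s * (cinner (snd q) g - cinner (fst q) g')" if "q \<in> T" for q
  proof -
    obtain h h' where q: "q = (h, h')" by fastforce
    then have "E h = embed S (\<Gamma> h)" using E that unfolding is_extended_boundary_map_def by blast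
    then show ?thesis using green[of h h' g g'] q that g x by (simp add: embed_def x_def)
  qed
  have "(\<lambda>n. s * (cinner (snd (p n)) g - cinner (fst (p n)) g'))
      \<longlonglongrightarrow> s * (cinner (snd (f, f')) g - cinner (fst (f, f')) g')"
    using p(2)
    by (intro tendsto_intros bounded_linear.tendsto[OF bounded_linear_cinner_left] tendsto_fst tendsto_snd)
  then have lim1: "(\<lambda>n. E (fst (p n)) x) \<longlonglongrightarrow> s * (cinner f' g - cinner f g')"
    using E_T p(1) by simp
  have "cmod (E (fst (p n)) x - E f x) \<le> C * norm (p n - (f, f')) * N x" for n
  proof -
    obtain h h' where q: "p n = (h, h')" by fastforce
    have hB: "(h, h') \<in> B" using TB p(1)[of n] q by auto
    then have d: "(h - f, h' - f') \<in> B" using csubspace_diff[OF B(1) hB f] by simp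
    have "E (fst (p n)) x - E f x = E (h - f) x" using lin[OF DomainI[OF hB] DomainI[OF f]] q by simp
    moreover have "cmod (E (h - f) x) \<le> antidual_norm S N (E (h - f)) * N x"
      using antidual_bound[OF norm mem x] d by blast
    moreover have "0 \<le> N x" using norm x by (simp add: norm_on_def)
    ultimately show ?thesis
      using mult_right_mono[OF C[OF d], of "N x"] q by simp
  qed
  then have "\<forall>\<^sub>F n in sequentially. norm (E (fst (p n)) x - E f x) \<le> C * norm (p n - (f, f')) * N x"
    by (intro always_eventually allI)
  moreover have "(\<lambda>n. p n - (f, f')) \<longlonglongrightarrow> 0" using p(2) by (rule LIM_zero)
  then have "(\<lambda>n. C * norm (p n - (f, f')) * N x) \<longlonglongrightarrow> 0"
    by (intro tendsto_mult_left_zero tendsto_mult_right_zero tendsto_norm_zero)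
  ultimately have "(\<lambda>n. E (fst (p n)) x - E f x) \<longlonglongrightarrow> 0"
    by (rule Lim_null_comparison)
  then have "(\<lambda>n. E (fst (p n)) x) \<longlonglongrightarrow> E f x" by (rule LIM_zero_cancel)
  then show ?thesis using lim1 LIMSEQ_unique x_def by blast
qed

text \<open>
  The extension is defined by the right-hand side of Green's identity, with one chosen preimage of each
  \<open>x\<close> in the range space.  That the choice is compatible with addition and scaling is a closed
  condition which holds on \<open>T\<close>, and so is the bound by the graph norm.  The bound on \<open>T\<close> comes from
  uniform boundedness: for fixed \<open>x\<close> the right-hand side is at most a multiple of the graph norm.
\<close>

lemma extended_boundary_map_exists:
  fixes B T :: "('h::complex_hilbert \<times> 'h) set" and \<Gamma> \<Lambda> :: "'h \<Rightarrow> 'g::complex_hilbert"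
  assumes B: "csubspace B" "single_valued B" "closure T = B"
    and S: "reflexive_banach_embedded S N" "S = \<Lambda> ` K" "K \<subseteq> Domain T"
    and green: "\<And>f f' g g'. (f, f') \<in> T \<Longrightarrow> (g, g') \<in> T \<Longrightarrow> g \<in> K
      \<Longrightarrow> cinner (\<Gamma> f) (\<Lambda> g) = s * (cinner f' g - cinner f g')"
  shows "\<exists>E. is_extended_boundary_map B T \<Gamma> S N E"
proof -
  have norm: "norm_on S N" and complete: "complete_on S N"
    using S(1) unfolding reflexive_banach_embedded_def by blast+
  obtain C0 where C0: "\<And>x. x \<in> S \<Longrightarrow> norm x \<le> C0 * N x"
    using S(1) unfolding reflexive_banach_embedded_def by blast
  have sub: "csubspace S" and N_nonneg: "\<And>x. x \<in> S \<Longrightarrow> 0 \<le> N x"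
    using norm by (simp_all add: norm_on_def)
  have TB: "T \<subseteq> B" using B(3) closure_subset by blast
  have "\<exists>g g'. (g, g') \<in> T \<and> g \<in> K \<and> \<Lambda> g = x" if "x \<in> S" for x
    using that S(2,3) by blast
  then obtain G G' where G: "\<And>x. x \<in> S \<Longrightarrow> (G x, G' x) \<in> T \<and> G x \<in> K \<and> \<Lambda> (G x) = x"
    by metis
  define W where "W p x = s * (cinner (snd p) (G x) - cinner (fst p) (G' x))" for p x
  have W_T: "W p x = cinner (\<Gamma> (fst p)) x" if "p \<in> T" "x \<in> S" for p x
    using green[of "fst p" "snd p" "G x" "G' x"] G[OF that(2)] that(1) by (simp add: W_def)
  have cont: "continuous_on A (\<lambda>p. W p x)" for x A
    unfolding W_def by (intro continuous_intros)
  have on_B: "P" if "p \<in> B" "closed {p. Q p}" "\<And>p. p \<in> T \<Longrightarrow> Q p" "Q p \<Longrightarrow> P" for p P Q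
  proof -
    have "closure T \<subseteq> {p. Q p}" using that(2,3) by (intro closure_minimal) auto
    then show ?thesis using that(1,4) B(3) by blast
  qed
  have W_add: "W p (x + y) = W p x + W p y" if "p \<in> B" "x \<in> S" "y \<in> S" for p x y
    by (rule on_B[where Q="\<lambda>p. W p (x + y) = W p x + W p y", OF that(1)])
      (auto intro!: closed_Collect_eq continuous_intros cont
        simp: W_T that cinner_linear csubspace_add[OF sub])
  have W_scale: "W p (c *\<^sub>C x) = cnj c * W p x" if "p \<in> B" "x \<in> S" for p c x
    by (rule on_B[where Q="\<lambda>p. W p (c *\<^sub>C x) = cnj c * W p x", OF that(1)])
      (auto intro!: closed_Collect_eq continuous_intros cont
        simp: W_T that cinner_linear csubspace_scaleC[OF sub])
  (* Dividing by the graph norm restricts to the unit ball of T without rescaling its elements;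
     division by 0 only produces the zero functional. *)
  define F where "F = (\<lambda>p x. cinner (\<Gamma> (fst p)) x / complex_of_real (norm p)) ` T"
  have "\<exists>C\<ge>0. \<forall>\<phi>\<in>F. \<forall>x\<in>S. cmod (\<phi> x) \<le> C * N x"
  proof (rule uniform_boundedness[OF norm complete])
    fix \<phi> assume "\<phi> \<in> F"
    then obtain p where p: "p \<in> T" "\<phi> = (\<lambda>x. cinner (\<Gamma> (fst p)) x / complex_of_real (norm p))"
      unfolding F_def by blast
    show "x \<in> S \<Longrightarrow> y \<in> S \<Longrightarrow> \<phi> (x + y) = \<phi> x + \<phi> y" for x y
      by (simp add: p cinner_linear add_divide_distrib)
    show "x \<in> S \<Longrightarrow> \<phi> (c *\<^sub>C x) = cnj c * \<phi> x" for c x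
      by (simp add: p cinner_linear)
    have "cmod (\<phi> x) \<le> (norm (\<Gamma> (fst p)) * C0 / norm p) * N x" if "x \<in> S" for x
    proof -
      have "cmod (cinner (\<Gamma> (fst p)) x) \<le> norm (\<Gamma> (fst p)) * norm x" by (rule cinner_cauchy_schwarz)
      also have "\<dots> \<le> norm (\<Gamma> (fst p)) * (C0 * N x)" using C0[OF that] by (rule mult_left_mono) simp
      finally show ?thesis
        using divide_right_mono[of "cmod (cinner (\<Gamma> (fst p)) x)" _ "norm p"]
        by (simp add: p norm_divide mult.assoc)
    qed
    then show "\<exists>C. \<forall>x\<in>S. cmod (\<phi> x) \<le> C * N x" by blast
  next
    fix x assume x: "x \<in> S"
    have "cmod (\<phi> x) \<le> cmod s * (norm (G x) + norm (G' x))" if phi: "\<phi> \<in> F" for \<phi>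
    proof -
      obtain p where p: "p \<in> T" "\<phi> = (\<lambda>x. cinner (\<Gamma> (fst p)) x / complex_of_real (norm p))"
        using phi unfolding F_def by blast
      have "cmod (cinner (snd p) (G x) - cinner (fst p) (G' x))
          \<le> norm (snd p) * norm (G x) + norm (fst p) * norm (G' x)"
        using norm_triangle_ineq4 cinner_cauchy_schwarz add_mono order_trans by meson
      also have "\<dots> \<le> norm p * norm (G x) + norm p * norm (G' x)"
        using norm_fst_le[of "fst p" "snd p"] norm_snd_le[of "snd p" "fst p"]
        by (intro add_mono mult_right_mono) auto
      finally have "cmod (W p x) \<le> cmod s * (norm p * (norm (G x) + norm (G' x)))"
        unfolding W_def norm_mult by (intro mult_left_mono) (auto simp: distrib_left)
      then have *: "cmod (W p x) \<le> (cmod s * (norm (G x) + norm (G' x))) * norm p"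
        by (simp add: mult_ac)
      show ?thesis
      proof (cases "norm p = 0")
        case False
        then show ?thesis using * W_T[OF p(1) x]
          by (simp add: p norm_divide pos_divide_le_eq)
      qed (simp add: p)
    qed
    then show "\<exists>K. \<forall>\<phi>\<in>F. cmod (\<phi> x) \<le> K" by blast
  qed
  then obtain C where C: "C \<ge> 0" "\<And>\<phi> x. \<phi> \<in> F \<Longrightarrow> x \<in> S \<Longrightarrow> cmod (\<phi> x) \<le> C * N x" by blast
  have W_T_bound: "cmod (W p x) \<le> C * N x * norm p" if "p \<in> T" "x \<in> S" for p x
  proof (cases "norm p = 0")
    case False
    have "cmod (cinner (\<Gamma> (fst p)) x) / norm p \<le> C * N x"
      using C(2)[of "\<lambda>x. cinner (\<Gamma> (fst p)) x / complex_of_real (norm p)" x] that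
      by (auto simp: F_def norm_divide)
    then show ?thesis using False W_T[OF that] by (simp add: pos_divide_le_eq)
  qed (simp add: W_def)
  have W_bound: "cmod (W p x) \<le> C * N x * norm p" if "p \<in> B" "x \<in> S" for p x
    by (rule on_B[where Q="\<lambda>p. cmod (W p x) \<le> C * N x * norm p", OF that(1)])
      (auto intro!: closed_Collect_le continuous_intros cont W_T_bound that)
  define b where "b f = (SOME f'. (f, f') \<in> B)" for f
  have b: "b f = f'" if "(f, f') \<in> B" for f f'
    unfolding b_def using that B(2) by (metis single_valuedD someI)
  define E where "E f = (\<lambda>x. if f \<in> Domain B \<and> x \<in> S then W (f, b f) x else 0)" for f
  have E_eq: "E f = (\<lambda>x. if x \<in> S then W (f, f') x else 0)" if "(f, f') \<in> B" for f f'
    using DomainI[OF that] b[OF that] by (auto simp: E_def fun_eq_iff)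
  have "is_extended_boundary_map B T \<Gamma> S N E"
    unfolding is_extended_boundary_map_def
  proof (intro conjI)
    show "E ` Domain B \<subseteq> antidual S N"
    proof clarify
      fix f f' assume f: "(f, f') \<in> B"
      have "cmod (W (f, f') x) \<le> (C * norm (f, f')) * N x" if "x \<in> S" for x
        using W_bound[OF f that] by (simp add: mult_ac)
      then show "E f \<in> antidual S N"
        unfolding antidual_def E_eq[OF f] using W_add[OF f] W_scale[OF f]
        by (auto simp: csubspace_add[OF sub] csubspace_scaleC[OF sub])
    qed
    show "clinear_on (Domain B) E"
      unfolding clinear_on_def
    proof (intro conjI ballI allI)
      fix f h assume "f \<in> Domain B" "h \<in> Domain B"
      then obtain f' h' where f: "(f, f') \<in> B" and h: "(h, h') \<in> B" by blast
      have "(f + h, f' + h') \<in> B" using csubspace_add[OF B(1) f h] by simp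
      then show "E (f + h) = E f + E h"
        by (auto simp: E_eq[OF f] E_eq[OF h] E_eq W_def cinner_linear algebra_simps fun_eq_iff)
    next
      fix c f assume "f \<in> Domain B"
      then obtain f' where f: "(f, f') \<in> B" by blast
      have "(c *\<^sub>C f, c *\<^sub>C f') \<in> B" using csubspace_scaleC[OF B(1) f, of c] by (simp add: scaleC_prod_def)
      then show "E (c *\<^sub>C f) = c *\<^sub>C E f"
        by (auto simp: E_eq[OF f] E_eq W_def cinner_linear algebra_simps fun_eq_iff scaleC_fun_def scaleC_complex_def)
    qed
    show "\<forall>f\<in>Domain T. E f = embed S (\<Gamma> f)"
    proof clarify
      fix f f' assume f: "(f, f') \<in> T"
      show "E f = embed S (\<Gamma> f)"
        using E_eq[of f f'] f TB W_T[OF f] by (auto simp: embed_def fun_eq_iff)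
    qed
    have "antidual_norm S N (E f) \<le> C * norm (f, f')" if f: "(f, f') \<in> B" for f f'
      using W_bound[OF f] C(1) by (intro antidual_norm_le[OF norm]) (auto simp: E_eq[OF f] mult_ac)
    then show "\<exists>C. \<forall>(f, f')\<in>B. antidual_norm S N (E f) \<le> C * norm (f, f')" by blast
    show "\<forall>f. f \<notin> Domain B \<longrightarrow> E f = 0" by (auto simp: E_def)
  qed
  then show ?thesis by blast
qed

theorem extended_boundary_map_characterization:
  fixes B T :: "('h::complex_hilbert \<times> 'h) set" and \<Gamma> \<Lambda> :: "'h \<Rightarrow> 'g::complex_hilbert"
  assumes B: "csubspace B" "single_valued B" "closure T = B"
    and S: "reflexive_banach_embedded S N" "S = \<Lambda> ` K" "K \<subseteq> Domain T"
    and green: "\<And>f f' g g'. (f, f') \<in> T \<Longrightarrow> (g, g') \<in> T \<Longrightarrow> g \<in> K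
      \<Longrightarrow> cinner (\<Gamma> f) (\<Lambda> g) = s * (cinner f' g - cinner f g')"
  shows "is_extended_boundary_map B T \<Gamma> S N (extended_boundary_map B T \<Gamma> S N)"
    and "(f, f') \<in> B \<Longrightarrow> (g, g') \<in> T \<Longrightarrow> g \<in> K
      \<Longrightarrow> extended_boundary_map B T \<Gamma> S N f (\<Lambda> g) = s * (cinner f' g - cinner f g')"
proof -
  have norm: "norm_on S N" using S(1) unfolding reflexive_banach_embedded_def by blast
  have pairing: "E f (\<Lambda> g) = s * (cinner f' g - cinner f g')"
    if "is_extended_boundary_map B T \<Gamma> S N E" "(f, f') \<in> B" "(g, g') \<in> T" "g \<in> K" for E f f' g g'
    by (rule extended_boundary_map_pairing[OF B(1,3) norm S(2) _ that]) (rule green)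
  obtain E where E: "is_extended_boundary_map B T \<Gamma> S N E"
    using extended_boundary_map_exists[OF assms] by blast
  have unique: "E1 = E2" if E1: "is_extended_boundary_map B T \<Gamma> S N E1"
    and E2: "is_extended_boundary_map B T \<Gamma> S N E2" for E1 E2
  proof
    fix f
    show "E1 f = E2 f"
    proof (cases "f \<in> Domain B")
      case True
      then obtain f' where f: "(f, f') \<in> B" by blast
      show ?thesis
      proof (rule antidual_ext)
        show "E1 f \<in> antidual S N" "E2 f \<in> antidual S N"
          using E1 E2 True unfolding is_extended_boundary_map_def by blast+
        fix x assume "x \<in> S"
        then obtain g g' where "(g, g') \<in> T" "g \<in> K" "x = \<Lambda> g" using S(2,3) by blast
        then show "E1 f x = E2 f x" using pairing[OF E1 f] pairing[OF E2 f] by simp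
      qed
    qed (use E1 E2 in \<open>simp add: is_extended_boundary_map_def\<close>)
  qed
  have ext: "is_extended_boundary_map B T \<Gamma> S N (extended_boundary_map B T \<Gamma> S N)"
    unfolding extended_boundary_map_def
    by (rule theI'[of "is_extended_boundary_map B T \<Gamma> S N"]) (use E unique in blast)
  show "is_extended_boundary_map B T \<Gamma> S N (extended_boundary_map B T \<Gamma> S N)" by (fact ext)
  show "extended_boundary_map B T \<Gamma> S N f (\<Lambda> g) = s * (cinner f' g - cinner f g')"
    if "(f, f') \<in> B" "(g, g') \<in> T" "g \<in> K" by (rule pairing[OF ext that])
qed

section \<open>Adjoints and resolvents\<close>

lemma in_rel_diff_scalar: "(f, h) \<in> \<Theta> \<boxminus> scalar_rel \<mu> \<longleftrightarrow> (f, h + \<mu> *\<^sub>C f) \<in> \<Theta>"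
proof -
  have "(f, h) \<in> \<Theta> \<boxminus> scalar_rel \<mu> \<longleftrightarrow> (\<exists>f'. (f, f') \<in> \<Theta> \<and> h = f' - \<mu> *\<^sub>C f)"
    by (auto simp: rel_diff_def scalar_rel_def op_graph_def)
  then show ?thesis by (metis add_diff_cancel_right' diff_add_cancel)
qed

lemma in_resolvent: "(h, f) \<in> resolvent \<Theta> \<mu> \<longleftrightarrow> (f, h + \<mu> *\<^sub>C f) \<in> \<Theta>"
  by (simp add: resolvent_def in_rel_diff_scalar)

lemma rel_ker_diff_scalar: "rel_ker (\<Theta> \<boxminus> scalar_rel \<mu>) = {f. (f, \<mu> *\<^sub>C f) \<in> \<Theta>}"
  by (simp add: rel_ker_def in_rel_diff_scalar)

lemma cadjointD: "(g, g') \<in> cadjoint S \<Longrightarrow> (f, f') \<in> S \<Longrightarrow> cinner f' g = cinner f g'"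
  unfolding cadjoint_def by blast

lemma cadjointI: "(\<And>f f'. (f, f') \<in> S \<Longrightarrow> cinner f' g = cinner f g') \<Longrightarrow> (g, g') \<in> cadjoint S"
  unfolding cadjoint_def by blast

lemma csubspace_cadjoint: "csubspace (cadjoint S)"
  unfolding csubspace_def cadjoint_def zero_prod_def
  by (auto simp: scaleC_prod_def cinner_linear dest!: bspec)

lemma closed_cadjoint: "closed (cadjoint S)"
proof -
  have "cadjoint S = (\<Inter>p\<in>S. {q. cinner (snd p) (fst q) = cinner (fst p) (snd q)})"
    unfolding cadjoint_def by fastforce
  then show ?thesis
    by (auto intro!: closed_INT closed_Collect_eq continuous_intros)
qed

lemma single_valued_cadjoint: "densely_defined S \<Longrightarrow> single_valued (cadjoint S)"
  unfolding densely_defined_def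
  by (intro single_valuedI, erule dense_separates_right) (auto dest!: cadjointD)

text \<open>Meaningful for points of the resolvent set only.\<close>

definition resolvent_op :: "('a::complex_vector \<times> 'a) set \<Rightarrow> complex \<Rightarrow> 'a \<Rightarrow> 'a" where
  "resolvent_op \<Theta> \<mu> h = (THE f. (f, h + \<mu> *\<^sub>C f) \<in> \<Theta>)"

lemma resolvent_op_iff:
  assumes "\<mu> \<in> resolvent_set \<Theta>"
  shows "(f, h + \<mu> *\<^sub>C f) \<in> \<Theta> \<longleftrightarrow> f = resolvent_op \<Theta> \<mu> h"
proof -
  have sv: "single_valued (resolvent \<Theta> \<mu>)" and "h \<in> Domain (resolvent \<Theta> \<mu>)"
    using assms unfolding resolvent_set_def by auto
  then obtain k where "(h, k) \<in> resolvent \<Theta> \<mu>" by blast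
  then have k: "(f, h + \<mu> *\<^sub>C f) \<in> \<Theta> \<longleftrightarrow> f = k" for f
    using sv unfolding in_resolvent[symmetric] by (auto dest: single_valuedD)
  then show ?thesis by (simp add: resolvent_op_def)
qed

lemma resolvent_op_mem:
  "\<mu> \<in> resolvent_set \<Theta> \<Longrightarrow> (resolvent_op \<Theta> \<mu> h, h + \<mu> *\<^sub>C resolvent_op \<Theta> \<mu> h) \<in> \<Theta>"
  by (simp add: resolvent_op_iff)

lemma resolvent_op_eq:
  "\<mu> \<in> resolvent_set \<Theta> \<Longrightarrow> (f, f') \<in> \<Theta> \<Longrightarrow> resolvent_op \<Theta> \<mu> (f' - \<mu> *\<^sub>C f) = f"
  using resolvent_op_iff[of \<mu> \<Theta> f "f' - \<mu> *\<^sub>C f"] by simp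

lemma resolvent_eq_op_graph:
  "\<mu> \<in> resolvent_set \<Theta> \<Longrightarrow> resolvent \<Theta> \<mu> = op_graph UNIV (resolvent_op \<Theta> \<mu>)"
  by (auto simp: in_resolvent resolvent_op_iff op_graph_def)

lemma resolvent_op_bounded:
  assumes "\<mu> \<in> resolvent_set \<Theta>"
  shows "\<exists>C\<ge>0. \<forall>h. norm (resolvent_op \<Theta> \<mu> h) \<le> C * norm h"
proof -
  obtain C where C: "\<And>h f. (h, f) \<in> resolvent \<Theta> \<mu> \<Longrightarrow> norm f \<le> C * norm h"
    using assms unfolding resolvent_set_def by blast
  have "norm (resolvent_op \<Theta> \<mu> h) \<le> \<bar>C\<bar> * norm h" for h
    using C[of h "resolvent_op \<Theta> \<mu> h"] mult_right_mono[OF abs_ge_self, of "norm h" C]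
      resolvent_op_mem[OF assms, of h] unfolding in_resolvent by auto
  then show ?thesis by (meson abs_ge_zero)
qed

lemma resolvent_op_linear:
  assumes "csubspace \<Theta>" "\<mu> \<in> resolvent_set \<Theta>"
  shows "resolvent_op \<Theta> \<mu> (h + k) = resolvent_op \<Theta> \<mu> h + resolvent_op \<Theta> \<mu> k"
    and "resolvent_op \<Theta> \<mu> (c *\<^sub>C h) = c *\<^sub>C resolvent_op \<Theta> \<mu> h"
proof -
  note mem = resolvent_op_mem[OF assms(2)]
  show "resolvent_op \<Theta> \<mu> (h + k) = resolvent_op \<Theta> \<mu> h + resolvent_op \<Theta> \<mu> k"
    by (rule sym, rule resolvent_op_iff[OF assms(2), THEN iffD1])
      (use csubspace_add[OF assms(1) mem mem, of h k] in \<open>simp add: algebra_simps scaleC_add_right\<close>)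
  show "resolvent_op \<Theta> \<mu> (c *\<^sub>C h) = c *\<^sub>C resolvent_op \<Theta> \<mu> h"
    by (rule sym, rule resolvent_op_iff[OF assms(2), THEN iffD1])
      (use csubspace_scaleC[OF assms(1) mem, of c h] in
        \<open>simp add: scaleC_prod_def scaleC_add_right scaleC_scaleC mult.commute\<close>)
qed

lemma norm_le_of_square_le:
  fixes x :: "'a::real_normed_vector"
  assumes "(norm x)\<^sup>2 \<le> a * norm x" "0 \<le> a"
  shows "norm x \<le> a"
  using assms by (cases "norm x = 0") (auto simp: power2_eq_square)

text \<open>
  The inverse of \<open>S - cnj \<mu>\<close> is the adjoint of the inverse of \<open>S - \<mu>\<close>, which exists by the Riesz
  representation theorem.
\<close>

lemma cnj_in_resolvent_set:
  assumes S: "selfadjoint_op S" and \<mu>: "\<mu> \<in> resolvent_set S"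
  shows "cnj \<mu> \<in> resolvent_set S"
proof -
  have sub: "csubspace S" and adj: "cadjoint S = S"
    using S unfolding selfadjoint_op_def lin_op_def by auto
  let ?R = "resolvent_op S \<mu>"
  obtain C where C: "C \<ge> 0" "\<And>h. norm (?R h) \<le> C * norm h"
    using resolvent_op_bounded[OF \<mu>] by blast
  have unique: "d = 0" if "(d, cnj \<mu> *\<^sub>C d) \<in> S" for d
  proof -
    have "cinner (d + \<mu> *\<^sub>C ?R d) d = cinner (?R d) (cnj \<mu> *\<^sub>C d)"
      using that resolvent_op_mem[OF \<mu>] by (intro cadjointD[of _ _ S]) (simp_all add: adj)
    then show ?thesis by (simp add: cinner_linear cinner_self)
  qed
  have exist: "\<exists>k. (k, y + cnj \<mu> *\<^sub>C k) \<in> S \<and> norm k \<le> C * norm y" for y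
  proof -
    have "cmod (cinner y (?R x)) \<le> (norm y * C) * norm x" for x
      using mult_left_mono[OF C(2)[of x], of "norm y"] cinner_cauchy_schwarz[of y "?R x"] by simp
    then obtain k where k: "\<And>x. cinner y (?R x) = cinner k x"
      using riesz_representation[of UNIV "\<lambda>x. cinner y (?R x)" "norm y * C"]
      by (auto simp: csubspace_UNIV resolvent_op_linear[OF sub \<mu>] cinner_linear)
    have "cinner f' k = cinner f (y + cnj \<mu> *\<^sub>C k)" if "(f, f') \<in> S" for f f'
    proof -
      have "cinner y f = cinner k (f' - \<mu> *\<^sub>C f)"
        using k[of "f' - \<mu> *\<^sub>C f"] resolvent_op_eq[OF \<mu> that] by simp
      then have "cinner f y = cinner (f' - \<mu> *\<^sub>C f) k" by (metis cinner_commute)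
      then show ?thesis by (simp add: cinner_linear)
    qed
    then have "(k, y + cnj \<mu> *\<^sub>C k) \<in> S" using cadjointI[of S] adj by blast
    moreover have "(norm k)\<^sup>2 = Re (cinner y (?R k))" by (simp add: k Re_cinner_self)
    then have "(norm k)\<^sup>2 \<le> (C * norm y) * norm k"
      using complex_Re_le_cmod[of "cinner y (?R k)"] cinner_cauchy_schwarz[of y "?R k"]
        mult_left_mono[OF C(2)[of k], of "norm y"] by (simp add: mult_ac)
    then have "norm k \<le> C * norm y" using C(1) by (intro norm_le_of_square_le) auto
    ultimately show ?thesis by blast
  qed
  have sv: "single_valued (resolvent S (cnj \<mu>))"
  proof (rule single_valuedI)
    fix h f k assume "(h, f) \<in> resolvent S (cnj \<mu>)" "(h, k) \<in> resolvent S (cnj \<mu>)"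
    then have "(f - k, cnj \<mu> *\<^sub>C (f - k)) \<in> S"
      using csubspace_diff[OF sub, of "(f, h + cnj \<mu> *\<^sub>C f)" "(k, h + cnj \<mu> *\<^sub>C k)"]
      by (simp add: in_resolvent complex_vector.scale_right_diff_distrib)
    then show "f = k" using unique by force
  qed
  have "norm f \<le> C * norm h" if "(h, f) \<in> resolvent S (cnj \<mu>)" for h f
    using exist[of h] that single_valuedD[OF sv that] unfolding in_resolvent by blast
  then have "\<exists>C. \<forall>(h, f) \<in> resolvent S (cnj \<mu>). norm f \<le> C * norm h" by blast
  moreover have "Domain (resolvent S (cnj \<mu>)) = UNIV"
    using exist by (fastforce simp: in_resolvent Domain_iff)
  ultimately show ?thesis using sv unfolding resolvent_set_def by blast
qed

section \<open>The extended gamma-field\<close>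

text \<open>
  What the \<open>\<gamma>\<close>-field needs of a quasi boundary triple: a self-adjoint \<open>A0\<close> between \<open>A\<close> and its adjoint,
  the map \<open>\<Gamma>1\<close> on the domain of \<open>A0\<close>, and the extension \<open>E0\<close> of \<open>\<Gamma>0\<close>.  Since elements of the anti-dual
  are determined by their values on \<open>G1\<close>, the assumption \<open>E0_pairing\<close> determines \<open>E0\<close>.
\<close>

locale extended_gamma_field =
  fixes A A0 :: "('h::complex_hilbert \<times> 'h) set" and \<Gamma>1 :: "'h \<Rightarrow> 'g::complex_hilbert"
    and G1 :: "'g set" and N1 :: "'g \<Rightarrow> real" and E0 :: "'h \<Rightarrow> 'g \<Rightarrow> complex"
  assumes A: "densely_defined A" "A \<subseteq> A0" "A0 \<subseteq> cadjoint A"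
    and selfadjoint: "selfadjoint_op A0"
    and \<Gamma>1_linear: "clinear_on (Domain A0) \<Gamma>1"
    and \<Gamma>1_A: "\<And>f. f \<in> Domain A \<Longrightarrow> \<Gamma>1 f = 0"
    and \<Gamma>1_bounded: "\<exists>C\<ge>0. \<forall>(g, g') \<in> A0. N1 (\<Gamma>1 g) \<le> C * (norm g + norm g')"
    and G1: "G1 = \<Gamma>1 ` Domain A0"
    and N1: "norm_on G1 N1" "\<exists>C. \<forall>x\<in>G1. norm x \<le> C * N1 x"
    and E0_antidual: "\<And>f. f \<in> Domain (cadjoint A) \<Longrightarrow> E0 f \<in> antidual G1 N1"
    and E0_linear: "clinear_on (Domain (cadjoint A)) E0"
    and E0_bounded: "\<exists>C. \<forall>(f, f') \<in> cadjoint A. antidual_norm G1 N1 (E0 f) \<le> C * norm (f, f')"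
    and E0_pairing: "\<And>f f' g g'. (f, f') \<in> cadjoint A \<Longrightarrow> (g, g') \<in> A0
      \<Longrightarrow> E0 f (\<Gamma>1 g) = cinner f g' - cinner f' g"
begin

abbreviation "\<gamma> \<equiv> extended_gamma (cadjoint A) E0"

text \<open>This is the adjoint of \<open>\<gamma> (cnj \<mu>)\<close>; see \<open>dual_map_gamma\<close>.\<close>

definition "L \<mu> h = \<Gamma>1 (resolvent_op A0 \<mu> h)"

lemma csubspace_A0: "csubspace A0" and cadjoint_A0: "cadjoint A0 = A0"
  using selfadjoint unfolding selfadjoint_op_def lin_op_def by auto

lemma csubspace_G1: "csubspace G1"
  using N1(1) by (simp add: norm_on_def)

lemma embed_mem: "embed G1 x \<in> antidual G1 N1"
  using N1(2) embed_in_antidual[OF csubspace_G1] by blast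

lemma antidual_separates:
  assumes "x \<in> G1" "y \<in> G1" "\<And>\<phi>. \<phi> \<in> antidual G1 N1 \<Longrightarrow> \<phi> x = \<phi> y"
  shows "x = y"
proof -
  have "cinner g x = cinner g y" for g
    using assms(3)[OF embed_mem[of g]] assms(1,2) by (simp add: embed_def)
  then show ?thesis using dense_separates_right[of UNIV x y] by simp
qed

text \<open>
  By the pairing, \<open>E0 f = 0\<close> says that \<open>(f, f')\<close> belongs to the adjoint of \<open>A0\<close>, which is \<open>A0\<close>.
\<close>

lemma E0_eq_0_iff:
  assumes f: "(f, f') \<in> cadjoint A"
  shows "E0 f = 0 \<longleftrightarrow> (f, f') \<in> A0"
proof -
  have "E0 f = 0 \<longleftrightarrow> (\<forall>x\<in>G1. E0 f x = 0)"
    using antidualD(3)[OF E0_antidual[OF DomainI[OF f]]] by (auto simp: fun_eq_iff)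
  also have "\<dots> \<longleftrightarrow> (\<forall>(g, g') \<in> A0. E0 f (\<Gamma>1 g) = 0)"
    unfolding G1 by auto
  also have "\<dots> \<longleftrightarrow> (\<forall>(g, g') \<in> A0. cinner g' f = cinner g f')"
  proof -
    have "E0 f (\<Gamma>1 g) = 0 \<longleftrightarrow> cinner g' f = cinner g f'" if "(g, g') \<in> A0" for g g'
      using E0_pairing[OF f that] cinner_commute[of g' f] cinner_commute[of g f'] by simp
    then show ?thesis by blast
  qed
  also have "\<dots> \<longleftrightarrow> (f, f') \<in> A0"
    using cadjoint_A0 unfolding cadjoint_def by blast
  finally show ?thesis .
qed

lemma E0_diff: "f \<in> Domain (cadjoint A) \<Longrightarrow> h \<in> Domain (cadjoint A) \<Longrightarrow> E0 (f - h) = E0 f - E0 h"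
  by (rule clinear_on_diff[OF E0_linear csubspace_Domain[OF csubspace_cadjoint]])

context
  fixes \<mu> assumes \<mu>: "\<mu> \<in> resolvent_set A0"
begin

lemma cnj_\<mu>: "cnj \<mu> \<in> resolvent_set A0"
  by (rule cnj_in_resolvent_set[OF selfadjoint \<mu>])

lemma L_mem: "L \<mu> h \<in> G1"
  unfolding L_def G1 using resolvent_op_mem[OF \<mu>] by blast

lemma L_add: "L \<mu> (h + k) = L \<mu> h + L \<mu> k"
  and L_scaleC: "L \<mu> (c *\<^sub>C h) = c *\<^sub>C L \<mu> h"
  using \<Gamma>1_linear DomainI[OF resolvent_op_mem[OF \<mu>]]
  unfolding L_def resolvent_op_linear[OF csubspace_A0 \<mu>] clinear_on_def by blast+

lemma L_eq: "(g, g') \<in> A0 \<Longrightarrow> L \<mu> (g' - \<mu> *\<^sub>C g) = \<Gamma>1 g"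
  by (simp add: L_def resolvent_op_eq[OF \<mu>])

lemma L_bounded: "\<exists>C\<ge>0. \<forall>h. N1 (L \<mu> h) \<le> C * norm h"
proof -
  obtain C where C: "C \<ge> 0" "\<And>g g'. (g, g') \<in> A0 \<Longrightarrow> N1 (\<Gamma>1 g) \<le> C * (norm g + norm g')"
    using \<Gamma>1_bounded by blast
  obtain D where D: "D \<ge> 0" "\<And>h. norm (resolvent_op A0 \<mu> h) \<le> D * norm h"
    using resolvent_op_bounded[OF \<mu>] by blast
  have "N1 (L \<mu> h) \<le> (C * (D + (1 + cmod \<mu> * D))) * norm h" for h
  proof -
    let ?g = "resolvent_op A0 \<mu> h"
    have "norm (h + \<mu> *\<^sub>C ?g) \<le> norm h + cmod \<mu> * (D * norm h)"
      using norm_triangle_ineq[of h "\<mu> *\<^sub>C ?g"] mult_left_mono[OF D(2)[of h], of "cmod \<mu>"]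
      by (simp add: norm_scaleC)
    then have "norm ?g + norm (h + \<mu> *\<^sub>C ?g) \<le> (D + (1 + cmod \<mu> * D)) * norm h"
      using D(2)[of h] by (simp add: algebra_simps)
    then have "C * (norm ?g + norm (h + \<mu> *\<^sub>C ?g)) \<le> C * ((D + (1 + cmod \<mu> * D)) * norm h)"
      using C(1) by (rule mult_left_mono)
    then show ?thesis using C(2)[OF resolvent_op_mem[OF \<mu>, of h]] unfolding L_def mult.assoc by linarith
  qed
  moreover have "0 \<le> C * (D + (1 + cmod \<mu> * D))" using C(1) D(1) by simp
  ultimately show ?thesis by blast
qed

end

(* A new context for each layer: its lemmas use the previous layer at cnj \<mu>. *)
context
  fixes \<mu> assumes \<mu>: "\<mu> \<in> resolvent_set A0"
begin

lemma E0_inj_on_kernel: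
  "inj_on E0 (rel_ker (cadjoint A \<boxminus> scalar_rel \<mu>))"
proof (rule inj_onI, unfold rel_ker_diff_scalar mem_Collect_eq)
  fix f h assume f: "(f, \<mu> *\<^sub>C f) \<in> cadjoint A" and h: "(h, \<mu> *\<^sub>C h) \<in> cadjoint A" and "E0 f = E0 h"
  then have "E0 (f - h) = 0" using E0_diff[OF DomainI[OF f] DomainI[OF h]] by simp
  moreover have "(f - h, \<mu> *\<^sub>C (f - h)) \<in> cadjoint A"
    using csubspace_diff[OF csubspace_cadjoint f h] by (simp add: complex_vector.scale_right_diff_distrib)
  ultimately have "(f - h, 0 + \<mu> *\<^sub>C (f - h)) \<in> A0" by (simp add: E0_eq_0_iff)
  moreover have "(0, 0 + \<mu> *\<^sub>C 0) \<in> A0" using csubspace_0[OF csubspace_A0] by (simp add: zero_prod_def)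
  ultimately have "f - h = 0" 
    using resolvent_op_iff[OF \<mu>, of "f - h" 0] resolvent_op_iff[OF \<mu>, of 0 0] by simp
  then show "f = h" by simp
qed

text \<open>
  The preimage represents the functional \<open>h \<mapsto> \<phi> (L (cnj \<mu>) h)\<close>.  It lies in the kernel because \<open>\<Gamma>1\<close>
  vanishes on \<open>A\<close>.
\<close>

lemma E0_image_kernel:
  assumes \<phi>: "\<phi> \<in> antidual G1 N1"
  shows "\<exists>k. (k, \<mu> *\<^sub>C k) \<in> cadjoint A \<and> E0 k = \<phi>"
proof -
  note \<nu> = cnj_\<mu>[OF \<mu>]
  obtain C where C: "C \<ge> 0" "\<And>h. N1 (L (cnj \<mu>) h) \<le> C * norm h" using L_bounded[OF \<nu>] by blast
  obtain D where D: "\<And>x. x \<in> G1 \<Longrightarrow> cmod (\<phi> x) \<le> D * N1 x" using \<phi> unfolding antidual_def by blast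
  have "cmod (\<phi> (L (cnj \<mu>) h)) \<le> (\<bar>D\<bar> * C) * norm h" for h
  proof -
    have "0 \<le> N1 (L (cnj \<mu>) h)" using N1(1) L_mem[OF \<nu>] by (simp add: norm_on_def)
    then have "D * N1 (L (cnj \<mu>) h) \<le> \<bar>D\<bar> * (C * norm h)" using C(2)[of h] by (intro mult_mono) auto
    then show ?thesis using D[OF L_mem[OF \<nu>, of h]] by simp
  qed
  then obtain k where k: "\<And>h. \<phi> (L (cnj \<mu>) h) = cinner k h"
    using riesz_representation[of UNIV "\<lambda>h. \<phi> (L (cnj \<mu>) h)" "\<bar>D\<bar> * C"] antidualD(1,2)[OF \<phi>] L_mem[OF \<nu>]
    by (auto simp: csubspace_UNIV L_add[OF \<nu>] L_scaleC[OF \<nu>])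
  have k_A0: "\<phi> (\<Gamma>1 g) = cinner k g' - cinner (\<mu> *\<^sub>C k) g" if "(g, g') \<in> A0" for g g'
    using k[of "g' - cnj \<mu> *\<^sub>C g"] L_eq[OF \<nu> that] by (simp add: cinner_linear)
  have "0 \<in> G1" by (rule csubspace_0[OF csubspace_G1])
  then have \<phi>0: "\<phi> 0 = 0" using antidualD(2)[OF \<phi>, of 0 0] by simp
  have ker: "(k, \<mu> *\<^sub>C k) \<in> cadjoint A"
  proof (rule cadjointI)
    fix g g' assume g: "(g, g') \<in> A"
    have "cinner k g' = cinner (\<mu> *\<^sub>C k) g" 
      using k_A0[of g g'] \<Gamma>1_A[OF DomainI[OF g]] g A(2) \<phi>0 by auto
    then show "cinner g' k = cinner g (\<mu> *\<^sub>C k)" by (metis cinner_commute)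
  qed
  have "E0 k = \<phi>"
  proof (rule antidual_ext[OF E0_antidual \<phi>])
    show "k \<in> Domain (cadjoint A)" using ker by blast
    fix x assume "x \<in> G1"
    then obtain g g' where "(g, g') \<in> A0" "x = \<Gamma>1 g" using G1 by blast
    then show "E0 k x = \<phi> x" using E0_pairing[OF ker] k_A0 by simp
  qed
  then show ?thesis using ker by blast
qed

lemma gamma_E0:
  assumes "(k, \<mu> *\<^sub>C k) \<in> cadjoint A"
  shows "\<gamma> \<mu> (E0 k) = k"
  unfolding extended_gamma_def using assms
  by (intro the_inv_into_f_f[OF E0_inj_on_kernel]) (simp add: rel_ker_diff_scalar)

lemma
  assumes "\<phi> \<in> antidual G1 N1"
  shows gamma_mem: "(\<gamma> \<mu> \<phi>, \<mu> *\<^sub>C \<gamma> \<mu> \<phi>) \<in> cadjoint A"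
    and E0_gamma: "E0 (\<gamma> \<mu> \<phi>) = \<phi>"
proof -
  obtain k where k: "(k, \<mu> *\<^sub>C k) \<in> cadjoint A" "E0 k = \<phi>"
    using E0_image_kernel[OF assms] by blast
  then have "\<gamma> \<mu> \<phi> = k" using gamma_E0[OF k(1)] by simp
  then show "(\<gamma> \<mu> \<phi>, \<mu> *\<^sub>C \<gamma> \<mu> \<phi>) \<in> cadjoint A" "E0 (\<gamma> \<mu> \<phi>) = \<phi>"
    using k by simp_all
qed

lemma cinner_gamma:
  assumes "\<phi> \<in> antidual G1 N1"
  shows "cinner (\<gamma> \<mu> \<phi>) h = \<phi> (L (cnj \<mu>) h)"
  using E0_pairing[OF gamma_mem[OF assms] resolvent_op_mem[OF cnj_\<mu>[OF \<mu>], of h]] E0_gamma[OF assms]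
  by (simp add: L_def cinner_linear)

lemma gamma_bounded:
  "\<exists>C\<ge>0. \<forall>\<phi>\<in>antidual G1 N1. norm (\<gamma> \<mu> \<phi>) \<le> C * antidual_norm G1 N1 \<phi>"
proof -
  note \<nu> = cnj_\<mu>[OF \<mu>]
  obtain C where C: "C \<ge> 0" "\<And>h. N1 (L (cnj \<mu>) h) \<le> C * norm h" using L_bounded[OF \<nu>] by blast
  have "norm (\<gamma> \<mu> \<phi>) \<le> C * antidual_norm G1 N1 \<phi>" if \<phi>: "\<phi> \<in> antidual G1 N1" for \<phi>
  proof -
    note nonneg = antidual_norm_nonneg[OF N1(1) \<phi>]
    have "cmod (\<phi> (L (cnj \<mu>) (\<gamma> \<mu> \<phi>))) \<le> antidual_norm G1 N1 \<phi> * N1 (L (cnj \<mu>) (\<gamma> \<mu> \<phi>))"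
      by (rule antidual_bound[OF N1(1) \<phi> L_mem[OF \<nu>]])
    also have "\<dots> \<le> antidual_norm G1 N1 \<phi> * (C * norm (\<gamma> \<mu> \<phi>))"
      using C(2) nonneg by (rule mult_left_mono)
    finally have "(norm (\<gamma> \<mu> \<phi>))\<^sup>2 \<le> (C * antidual_norm G1 N1 \<phi>) * norm (\<gamma> \<mu> \<phi>)"
      using complex_Re_le_cmod[of "cinner (\<gamma> \<mu> \<phi>) (\<gamma> \<mu> \<phi>)"] unfolding cinner_gamma[OF \<phi>, symmetric]
      by (simp add: Re_cinner_self mult_ac)
    then show ?thesis using C(1) nonneg by (intro norm_le_of_square_le) auto
  qed
  then show ?thesis using C(1) by blast
qed

lemma E0_bounded_on_kernel:
  "\<exists>C\<ge>0. \<forall>k. (k, \<mu> *\<^sub>C k) \<in> cadjoint A \<longrightarrow> antidual_norm G1 N1 (E0 k) \<le> C * norm k"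
proof -
  obtain C where C: "\<And>f f'. (f, f') \<in> cadjoint A \<Longrightarrow> antidual_norm G1 N1 (E0 f) \<le> C * norm (f, f')"
    using E0_bounded by blast
  have "antidual_norm G1 N1 (E0 k) \<le> (\<bar>C\<bar> * (1 + cmod \<mu>)) * norm k"
    if "(k, \<mu> *\<^sub>C k) \<in> cadjoint A" for k
  proof -
    have "norm (k, \<mu> *\<^sub>C k) \<le> (1 + cmod \<mu>) * norm k"
      using norm_Pair_le[of k "\<mu> *\<^sub>C k"] by (simp add: norm_scaleC algebra_simps)
    then have "C * norm (k, \<mu> *\<^sub>C k) \<le> \<bar>C\<bar> * ((1 + cmod \<mu>) * norm k)" by (intro mult_mono) auto
    then show ?thesis using C[OF that] by simp
  qed
  then show ?thesis by (intro exI[of _ "\<bar>C\<bar> * (1 + cmod \<mu>)"]) auto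
qed

text \<open>
  Subtracting the element of the kernel with the same value of \<open>E0\<close> leaves an element of \<open>A0\<close>.
\<close>

lemma decomposition:
  assumes f: "(f, f') \<in> cadjoint A"
  shows "f = resolvent_op A0 \<mu> (f' - \<mu> *\<^sub>C f) + \<gamma> \<mu> (E0 f)"
proof -
  have \<phi>: "E0 f \<in> antidual G1 N1" using E0_antidual f by blast
  let ?k = "\<gamma> \<mu> (E0 f)"
  have fk: "(f - ?k, f' - \<mu> *\<^sub>C ?k) \<in> cadjoint A"
    using csubspace_diff[OF csubspace_cadjoint f gamma_mem[OF \<phi>]] by simp
  have "E0 (f - ?k) = 0"
    using E0_diff[OF DomainI[OF f] DomainI[OF gamma_mem[OF \<phi>]]] E0_gamma[OF \<phi>] by simp
  then have "(f - ?k, f' - \<mu> *\<^sub>C ?k) \<in> A0" using E0_eq_0_iff[OF fk] by simp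
  from resolvent_op_eq[OF \<mu> this] show ?thesis
    by (simp add: complex_vector.scale_right_diff_distrib)
qed

end

context
  fixes \<mu> assumes \<mu>: "\<mu> \<in> resolvent_set A0"
begin

text \<open>
  Project any preimage of \<open>x\<close> orthogonally onto \<open>ker (A* - cnj \<mu>)\<close>, the range of \<open>\<gamma> (cnj \<mu>)\<close>.  As \<open>L \<mu>\<close> is
  the adjoint of \<open>\<gamma> (cnj \<mu>)\<close>, the projection \<open>h\<close> is again a preimage; and \<open>\<parallel>h\<parallel>\<^sup>2 = E0 h x\<close>, where \<open>E0\<close> is
  bounded on the kernel.
\<close>

lemma L_bounded_right_inverse:
  "\<exists>C\<ge>0. \<forall>x\<in>G1. \<exists>h. L \<mu> h = x \<and> norm h \<le> C * N1 x"
proof -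
  note \<nu> = cnj_\<mu>[OF \<mu>]
  obtain C where C: "C \<ge> 0"
    "\<And>k. (k, cnj \<mu> *\<^sub>C k) \<in> cadjoint A \<Longrightarrow> antidual_norm G1 N1 (E0 k) \<le> C * norm k"
    using E0_bounded_on_kernel[OF \<nu>] by blast
  define V where "V = {k. (k, cnj \<mu> *\<^sub>C k) \<in> cadjoint A}"
  have V: "csubspace V"
    unfolding csubspace_def
  proof (intro conjI ballI allI)
    note sub = csubspace_cadjoint[of A]
    show "0 \<in> V"
      using csubspace_0[OF sub] by (simp add: V_def zero_prod_def)
    fix x assume "x \<in> V"
    then have x: "(x, cnj \<mu> *\<^sub>C x) \<in> cadjoint A" by (simp add: V_def)
    show "c *\<^sub>C x \<in> V" for c
      using csubspace_scaleC[OF sub x, of c]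
      by (simp add: V_def scaleC_prod_def mult.commute)
    fix y assume "y \<in> V"
    then have y: "(y, cnj \<mu> *\<^sub>C y) \<in> cadjoint A" by (simp add: V_def)
    show "x + y \<in> V"
      using csubspace_add[OF sub x y] by (simp add: V_def scaleC_add_right)
  qed
  have "closed V"
  proof -
    have "bounded_linear (\<lambda>k::'h. cnj \<mu> *\<^sub>C k)"
      by (rule bounded_linear_intro[where K="cmod \<mu>"])
        (simp_all add: scaleC_add_right scaleR_scaleC norm_scaleC scaleC_scaleC mult.commute)
    then have "continuous_on UNIV (\<lambda>k::'h. (k, cnj \<mu> *\<^sub>C k))"
      by (intro continuous_on_Pair continuous_on_id linear_continuous_on)
    moreover have "V = (\<lambda>k. (k, cnj \<mu> *\<^sub>C k)) -` cadjoint A" by (auto simp: V_def)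
    ultimately show ?thesis using closed_vimage[OF closed_cadjoint] by simp
  qed
  have "\<exists>h. L \<mu> h = x \<and> norm h \<le> C * N1 x" if x: "x \<in> G1" for x
  proof -
    obtain g g' where "(g, g') \<in> A0" "x = \<Gamma>1 g" using x G1 by blast
    then obtain h0 where h0: "L \<mu> h0 = x" using L_eq[OF \<mu>] by blast
    obtain h where h: "h \<in> V" "\<And>v. v \<in> V \<Longrightarrow> cinner h0 v = cinner h v"
      using riesz_representation[OF V \<open>closed V\<close>, of "\<lambda>v. cinner h0 v" "norm h0"]
      by (auto simp: cinner_linear cinner_cauchy_schwarz)
    have Lh: "L \<mu> h = x"
    proof (rule antidual_separates[OF L_mem[OF \<mu>] x])
      fix \<phi> assume \<phi>: "\<phi> \<in> antidual G1 N1"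
      have "\<gamma> (cnj \<mu>) \<phi> \<in> V" using gamma_mem[OF \<nu> \<phi>] by (simp add: V_def)
      then have "cinner (\<gamma> (cnj \<mu>) \<phi>) h = cinner (\<gamma> (cnj \<mu>) \<phi>) h0" using h(2) by (metis cinner_commute)
      then show "\<phi> (L \<mu> h) = \<phi> x" using cinner_gamma[OF \<nu> \<phi>] h0 by simp
    qed
    have hV: "(h, cnj \<mu> *\<^sub>C h) \<in> cadjoint A" using h(1) by (simp add: V_def)
    have \<psi>: "E0 h \<in> antidual G1 N1" using E0_antidual hV by blast
    have nx: "0 \<le> N1 x" using N1(1) x by (simp add: norm_on_def)
    have "cinner h h = E0 h x" using cinner_gamma[OF \<nu> \<psi>, of h] gamma_E0[OF \<nu> hV] Lh by simp
    then have "(norm h)\<^sup>2 \<le> antidual_norm G1 N1 (E0 h) * N1 x"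
      using antidual_bound[OF N1(1) \<psi> x] complex_Re_le_cmod[of "cinner h h"] Re_cinner_self[of h] by simp
    also have "\<dots> \<le> (C * norm h) * N1 x" using C(2)[OF hV] nx by (rule mult_right_mono)
    finally have "norm h \<le> C * N1 x" using C(1) nx by (intro norm_le_of_square_le) (auto simp: mult_ac)
    then show ?thesis using Lh by blast
  qed
  then show ?thesis using C(1) by blast
qed

lemma dual_map_gamma: "dual_map G1 N1 (\<gamma> (cnj \<mu>)) h = L \<mu> h"
  unfolding dual_map_def
proof (rule the_equality)
  note \<nu> = cnj_\<mu>[OF \<mu>]
  have *: "cnj (\<phi> (L \<mu> h)) = cinner h (\<gamma> (cnj \<mu>) \<phi>)" if "\<phi> \<in> antidual G1 N1" for \<phi>
    using cinner_gamma[OF \<nu> that, of h] by (metis cinner_commute complex_cnj_cnj)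
  show "L \<mu> h \<in> G1 \<and> (\<forall>\<phi>\<in>antidual G1 N1. cnj (\<phi> (L \<mu> h)) = cinner h (\<gamma> (cnj \<mu>) \<phi>))"
    using * L_mem[OF \<mu>] by blast
  fix x assume x: "x \<in> G1 \<and> (\<forall>\<phi>\<in>antidual G1 N1. cnj (\<phi> x) = cinner h (\<gamma> (cnj \<mu>) \<phi>))"
  show "x = L \<mu> h"
  proof (rule antidual_separates[OF _ L_mem[OF \<mu>]])
    show "\<phi> x = \<phi> (L \<mu> h)" if "\<phi> \<in> antidual G1 N1" for \<phi>
      using *[OF that] x that by (metis complex_cnj_cancel_iff)
  qed (use x in blast)
qed

end

end

section \<open>Spectra of relations linked by a Krein-type resolvent formula\<close>

lemma rel_diff_scalar_0: "\<Theta> \<boxminus> scalar_rel 0 = \<Theta>"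
  by (auto simp: in_rel_diff_scalar)

text \<open>
  The assumption \<open>link\<close> is the identity \<open>(\<Theta> - \<mu>)\<^sup>-\<^sup>1 = R + g Q\<^sup>-\<^sup>1 l\<close> of relations.  When \<open>l\<close> is bounded and
  onto with a bounded right inverse, and \<open>g\<close> is bounded and bounded below, this identity transports kernel, density
  of the range and bounded invertibility between \<open>\<Theta> - \<mu>\<close> and \<open>Q\<close>.
\<close>

locale krein_link =
  fixes \<Theta> :: "('h::complex_hilbert \<times> 'h) set" and \<mu> :: complex
    and Q :: "('g::complex_hilbert \<times> 'g) set"
    and R :: "'h \<Rightarrow> 'h" and l :: "'h \<Rightarrow> 'g" and g :: "'g \<Rightarrow> 'h"
  assumes link: "\<And>f h. (f, h + \<mu> *\<^sub>C f) \<in> \<Theta> \<longleftrightarrow> (\<exists>y. (y, l h) \<in> Q \<and> f = R h + g y)"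
    and R_bounded: "\<exists>C\<ge>0. \<forall>h. norm (R h) \<le> C * norm h"
    and l_add: "\<And>h k. l (h + k) = l h + l k"
    and l_bounded: "\<exists>C\<ge>0. \<forall>h. norm (l h) \<le> C * norm h"
    and l_right_inverse: "\<exists>C\<ge>0. \<forall>x. \<exists>h. l h = x \<and> norm h \<le> C * norm x"
    and g_inj: "inj g"
    and g_bounded: "\<exists>C\<ge>0. \<forall>y. norm (g y) \<le> C * norm y"
    and g_below: "\<exists>C\<ge>0. \<forall>y. norm y \<le> C * norm (g y)"
begin

lemma zeros: "R 0 = 0" "l 0 = 0" "g 0 = 0"
  using R_bounded l_bounded g_bounded by (metis mult_zero_right norm_le_zero_iff norm_zero)+

lemma l_diff: "l (h - k) = l h - l k"
  by (metis add_diff_cancel_right' diff_add_cancel l_add)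

lemma kernel_eq: "rel_ker (\<Theta> \<boxminus> scalar_rel \<mu>) = g ` rel_ker Q"
proof -
  have "(f, \<mu> *\<^sub>C f) \<in> \<Theta> \<longleftrightarrow> (\<exists>y. (y, 0) \<in> Q \<and> f = g y)" for f
    using link[of f 0] by (simp add: zeros)
  then show ?thesis unfolding rel_ker_diff_scalar unfolding rel_ker_def by auto
qed

lemma kernel_trivial_iff: "rel_ker (\<Theta> \<boxminus> scalar_rel \<mu>) = {0} \<longleftrightarrow> rel_ker Q = {0}"
proof -
  have "g ` rel_ker Q = {0} \<longleftrightarrow> g ` rel_ker Q = g ` {0}" by (simp add: zeros)
  also have "\<dots> \<longleftrightarrow> rel_ker Q = {0}" using g_inj by (rule inj_image_eq_iff)
  finally show ?thesis by (simp add: kernel_eq)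
qed

lemma range_eq: "Range (\<Theta> \<boxminus> scalar_rel \<mu>) = l -` Range Q"
  using link by (auto simp: Range_iff in_rel_diff_scalar)

text \<open>
  The range of \<open>\<Theta> - \<mu>\<close> is the preimage of the range of \<open>Q\<close> under \<open>l\<close>; continuity of \<open>l\<close> gives one
  direction, the bounded right inverse (openness of \<open>l\<close>) the other.
\<close>

lemma dense_range_iff:
  "closure (Range (\<Theta> \<boxminus> scalar_rel \<mu>)) = UNIV \<longleftrightarrow> closure (Range Q) = UNIV"
proof
  obtain C where C: "C \<ge> 0" "\<And>x. \<exists>h. l h = x \<and> norm h \<le> C * norm x" using l_right_inverse by blast
  obtain D where D: "D \<ge> 0" "\<And>h. norm (l h) \<le> D * norm h" using l_bounded by blast
  {
    assume dense: "closure (Range (\<Theta> \<boxminus> scalar_rel \<mu>)) = UNIV"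
    have "x \<in> closure (Range Q)" for x
      unfolding closure_approachable
    proof (intro allI impI)
      fix e :: real assume e: "e > 0"
      obtain h where h: "l h = x" using C(2) by blast
      have "0 < e / (D + 1)" using e D(1) by simp
      then obtain k where k: "l k \<in> Range Q" "dist k h < e / (D + 1)"
        using dense unfolding range_eq closure_approachable by (metis UNIV_I closure_approachable vimageE)
      have "dist (l k) x \<le> D * norm (k - h)" using D(2)[of "k - h"] by (simp add: dist_norm l_diff h)
      also have "\<dots> \<le> (D + 1) * norm (k - h)" by (simp add: mult_right_mono)
      also have "\<dots> < (D + 1) * (e / (D + 1))"
        using k(2) D(1) by (intro mult_strict_left_mono) (auto simp: dist_norm)
      finally have "dist (l k) x < e" using D(1) by simp
      then show "\<exists>y\<in>Range Q. dist y x < e" using k(1) by blast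
    qed
    then show "closure (Range Q) = UNIV" by blast
  next
    assume dense: "closure (Range Q) = UNIV"
    have "h \<in> closure (l -` Range Q)" for h
      unfolding closure_approachable
    proof (intro allI impI)
      fix e :: real assume e: "e > 0"
      have "0 < e / (C + 1)" using e C(1) by simp
      then obtain x where x: "x \<in> Range Q" "dist x (l h) < e / (C + 1)"
        using dense by (metis UNIV_I closure_approachable)
      obtain k where k: "l k = x - l h" "norm k \<le> C * norm (x - l h)" using C(2) by blast
      have "norm k \<le> (C + 1) * norm (x - l h)"
        using k(2) norm_ge_zero[of "x - l h"] unfolding distrib_right by linarith
      also have "\<dots> < (C + 1) * (e / (C + 1))"
        using x(2) C(1) by (intro mult_strict_left_mono) (auto simp: dist_norm)
      finally have "dist (h + k) h < e" using C(1) by (simp add: dist_norm)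
      moreover have "h + k \<in> l -` Range Q" using x(1) k(1) by (simp add: l_add)
      ultimately show "\<exists>y\<in>l -` Range Q. dist y h < e" by blast
    qed
    then show "closure (Range (\<Theta> \<boxminus> scalar_rel \<mu>)) = UNIV" unfolding range_eq by blast
  }
qed

lemma resolvent_set_iff: "\<mu> \<in> resolvent_set \<Theta> \<longleftrightarrow> 0 \<in> resolvent_set Q"
proof
  obtain C where C: "C \<ge> 0" "\<And>x. \<exists>h. l h = x \<and> norm h \<le> C * norm x" using l_right_inverse by blast
  obtain D where D: "D \<ge> 0" "\<And>h. norm (l h) \<le> D * norm h" using l_bounded by blast
  obtain a where a: "a \<ge> 0" "\<And>y. norm (g y) \<le> a * norm y" using g_bounded by blast
  obtain b where b: "b \<ge> 0" "\<And>y. norm y \<le> b * norm (g y)" using g_below by blast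
  obtain r where r: "r \<ge> 0" "\<And>h. norm (R h) \<le> r * norm h" using R_bounded by blast
  have Q: "(x, y) \<in> resolvent Q 0 \<longleftrightarrow> (y, x) \<in> Q" for x y by (simp add: in_resolvent)
  have \<Theta>: "(h, f) \<in> resolvent \<Theta> \<mu> \<longleftrightarrow> (\<exists>y. (y, l h) \<in> Q \<and> f = R h + g y)" for h f
    by (simp add: in_resolvent link)
  {
    assume "\<mu> \<in> resolvent_set \<Theta>"
    then have sv: "single_valued (resolvent \<Theta> \<mu>)" and dom: "\<And>h. h \<in> Domain (resolvent \<Theta> \<mu>)"
      and bd: "\<exists>c. \<forall>(h, f) \<in> resolvent \<Theta> \<mu>. norm f \<le> c * norm h"
      unfolding resolvent_set_def by auto
    obtain c where c: "\<And>h f. (h, f) \<in> resolvent \<Theta> \<mu> \<Longrightarrow> norm f \<le> c * norm h" using bd by blast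
    have "single_valued (resolvent Q 0)"
    proof (rule single_valuedI)
      fix x y z assume xy: "(x, y) \<in> resolvent Q 0" and xz: "(x, z) \<in> resolvent Q 0"
      obtain h where h: "l h = x" using C(2) by blast
      have "(h, R h + g y) \<in> resolvent \<Theta> \<mu>" "(h, R h + g z) \<in> resolvent \<Theta> \<mu>"
        using xy xz h unfolding \<Theta> Q by auto
      then have "R h + g y = R h + g z" using sv by (auto dest: single_valuedD)
      then show "y = z" using g_inj by (simp add: inj_eq)
    qed
    moreover have "x \<in> Domain (resolvent Q 0)" for x
    proof -
      obtain h where h: "l h = x" using C(2) by blast
      obtain f where "(h, f) \<in> resolvent \<Theta> \<mu>" using dom by blast
      then show ?thesis using h unfolding \<Theta> Domain_iff Q by blast
    qed
    moreover have "norm y \<le> (b * ((\<bar>c\<bar> + r) * C)) * norm x" if xy: "(x, y) \<in> resolvent Q 0" for x y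
    proof -
      obtain h where h: "l h = x" "norm h \<le> C * norm x" using C(2) by blast
      have "(h, R h + g y) \<in> resolvent \<Theta> \<mu>" using xy h(1) unfolding \<Theta> Q by auto
      then have "norm (R h + g y) \<le> \<bar>c\<bar> * norm h"
        using c mult_right_mono[OF abs_ge_self, of "norm h" c] by force
      then have "norm (g y) \<le> (\<bar>c\<bar> + r) * norm h"
        using norm_triangle_ineq4[of "R h + g y" "R h"] r(2)[of h] by (simp add: distrib_right)
      also have "\<dots> \<le> (\<bar>c\<bar> + r) * (C * norm x)" using h(2) r(1) by (intro mult_left_mono) auto
      finally have "b * norm (g y) \<le> b * ((\<bar>c\<bar> + r) * (C * norm x))" using b(1) by (rule mult_left_mono)
      then show ?thesis using b(2)[of y] by (simp add: mult.assoc)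
    qed
    ultimately show "0 \<in> resolvent_set Q" unfolding resolvent_set_def by blast
  next
    assume "0 \<in> resolvent_set Q"
    then have sv: "single_valued (resolvent Q 0)" and dom: "\<And>h. h \<in> Domain (resolvent Q 0)"
      and bd: "\<exists>c. \<forall>(x, y) \<in> resolvent Q 0. norm y \<le> c * norm x"
      unfolding resolvent_set_def by auto
    obtain c where c: "\<And>x y. (x, y) \<in> resolvent Q 0 \<Longrightarrow> norm y \<le> c * norm x" using bd by blast
    have "single_valued (resolvent \<Theta> \<mu>)"
    proof (rule single_valuedI)
      fix h f k assume "(h, f) \<in> resolvent \<Theta> \<mu>" "(h, k) \<in> resolvent \<Theta> \<mu>"
      then obtain y z where "(l h, y) \<in> resolvent Q 0" "f = R h + g y"
        "(l h, z) \<in> resolvent Q 0" "k = R h + g z" unfolding \<Theta> Q by blast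
      then show "f = k" using sv by (auto dest: single_valuedD)
    qed
    moreover have "h \<in> Domain (resolvent \<Theta> \<mu>)" for h
    proof -
      obtain y where "(l h, y) \<in> resolvent Q 0" using dom by blast
      then show ?thesis unfolding \<Theta> Domain_iff Q by blast
    qed
    moreover have "norm f \<le> (r + a * (\<bar>c\<bar> * D)) * norm h" if hf: "(h, f) \<in> resolvent \<Theta> \<mu>" for h f
    proof -
      obtain y where y: "(l h, y) \<in> resolvent Q 0" "f = R h + g y" using hf unfolding \<Theta> Q by blast
      have "norm y \<le> \<bar>c\<bar> * norm (l h)"
        using c[OF y(1)] mult_right_mono[OF abs_ge_self, of "norm (l h)" c] by simp
      also have "\<dots> \<le> \<bar>c\<bar> * (D * norm h)" using D(2) by (intro mult_left_mono) auto
      finally have "a * norm y \<le> a * (\<bar>c\<bar> * (D * norm h))" using a(1) by (rule mult_left_mono)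
      then show ?thesis
        using norm_triangle_ineq[of "R h" "g y"] r(2)[of h] a(2)[of y] y(2)
        by (simp add: distrib_right mult.assoc)
    qed
    ultimately show "\<mu> \<in> resolvent_set \<Theta>" unfolding resolvent_set_def by blast
  }
qed

lemma point_spectrum_iff: "\<mu> \<in> point_spectrum \<Theta> \<longleftrightarrow> 0 \<in> point_spectrum Q"
  by (simp add: point_spectrum_def rel_diff_scalar_0 kernel_trivial_iff)

lemma continuous_spectrum_iff: "\<mu> \<in> continuous_spectrum \<Theta> \<longleftrightarrow> 0 \<in> continuous_spectrum Q"
  by (simp add: continuous_spectrum_def rel_diff_scalar_0 kernel_trivial_iff dense_range_iff
      resolvent_set_iff)

lemma residual_spectrum_iff: "\<mu> \<in> residual_spectrum \<Theta> \<longleftrightarrow> 0 \<in> residual_spectrum Q"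
  by (simp add: residual_spectrum_def rel_diff_scalar_0 kernel_trivial_iff dense_range_iff)

end

section \<open>Quasi boundary triples\<close>

lemma mem_restr_ker_in: "(f, f') \<in> restr T (ker_in T \<Gamma>) \<longleftrightarrow> (f, f') \<in> T \<and> \<Gamma> f = 0"
  by (auto simp: restr_def ker_in_def)

lemma Domain_restr_ker_in: "Domain (restr T (ker_in T \<Gamma>)) = ker_in T \<Gamma>"
  by (auto simp: restr_def ker_in_def)

text \<open>
  Two points need an argument.  First, \<open>A\<close> is contained in \<open>A0\<close>, since \<open>A0\<close> is contained in the adjoint
  of \<open>A\<close> and equals its own adjoint.  Second, \<open>\<Gamma>1\<close> vanishes on \<open>A\<close>: for \<open>f \<in> Domain A\<close> Green's
  identity reduces to \<open>cinner (\<Gamma>0 h) (\<Gamma>1 f) = 0\<close> for all \<open>h\<close>, and the range of \<open>\<Gamma>0\<close> is dense.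
\<close>

lemma extended_gamma_field_quasi_boundary_triple:
  fixes A T :: "('h::complex_hilbert \<times> 'h) set" and \<Gamma>0 \<Gamma>1 :: "'h \<Rightarrow> 'g::complex_hilbert"
  assumes A: "symmetric_op A" and triple: "quasi_boundary_triple A T \<Gamma>0 \<Gamma>1"
    and G1: "G1 = \<Gamma>1 ` ker_in T \<Gamma>0"
    and N1: "reflexive_banach_embedded G1 N1"
    and continuous: "continuous_after_resolvent (restr T (ker_in T \<Gamma>0)) \<Gamma>1 N1"
  shows "extended_gamma_field A (restr T (ker_in T \<Gamma>0)) \<Gamma>1 G1 N1
    (extended_boundary_map (cadjoint A) T \<Gamma>0 G1 N1)"
proof -
  let ?A0 = "restr T (ker_in T \<Gamma>0)" and ?E0 = "extended_boundary_map (cadjoint A) T \<Gamma>0 G1 N1"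
  have dense: "densely_defined A" and symmetric: "A \<subseteq> cadjoint A"
    using A by (simp_all add: symmetric_op_def)
  have T: "T \<subseteq> cadjoint A" "closure T = cadjoint A"
    and lin: "clinear_on (Domain T) \<Gamma>1"
    and range: "closure ((\<lambda>f. (\<Gamma>0 f, \<Gamma>1 f)) ` Domain T) = UNIV"
    and sa: "selfadjoint_op ?A0"
    and green: "\<And>f f' g g'. (f, f') \<in> T \<Longrightarrow> (g, g') \<in> T \<Longrightarrow>
      cinner f' g - cinner f g' = cinner (\<Gamma>1 f) (\<Gamma>0 g) - cinner (\<Gamma>0 f) (\<Gamma>1 g)"
    using triple unfolding quasi_boundary_triple_def by blast+
  have A0_T: "?A0 \<subseteq> T" by (auto simp: restr_def)
  have A_A0: "A \<subseteq> ?A0"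
  proof
    fix p assume p: "p \<in> A"
    obtain g g' where g: "p = (g, g')" by fastforce
    have "cinner f' g = cinner f g'" if "(f, f') \<in> ?A0" for f f'
    proof -
      have "cinner g' f = cinner g f'" using that A0_T T(1) p g by (intro cadjointD[of _ _ A]) auto
      then show ?thesis by (metis cinner_commute)
    qed
    then have "(g, g') \<in> cadjoint ?A0" by (rule cadjointI)
    then show "p \<in> ?A0" using sa g unfolding selfadjoint_op_def by simp
  qed
  have G1': "G1 = \<Gamma>1 ` Domain ?A0" using G1 by (simp add: Domain_restr_ker_in)
  have green0: "cinner (\<Gamma>0 f) (\<Gamma>1 g) = - 1 * (cinner f' g - cinner f g')"
    if "(f, f') \<in> T" "(g, g') \<in> T" "g \<in> ker_in T \<Gamma>0" for f f' g g'
    using green[OF that(1,2)] that(3) by (simp add: ker_in_def)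
  note B = csubspace_cadjoint[of A] single_valued_cadjoint[OF dense] T(2)
  have sub: "ker_in T \<Gamma>0 \<subseteq> Domain T" by (auto simp: ker_in_def)
  have E0: "is_extended_boundary_map (cadjoint A) T \<Gamma>0 G1 N1 ?E0"
    by (rule extended_boundary_map_characterization(1)[OF B N1 G1 sub]) (rule green0)
  have pairing: "?E0 f (\<Gamma>1 g) = - 1 * (cinner f' g - cinner f g')"
    if "(f, f') \<in> cadjoint A" "(g, g') \<in> T" "g \<in> ker_in T \<Gamma>0" for f f' g g'
    by (rule extended_boundary_map_characterization(2)[OF B N1 G1 sub _ that]) (rule green0)
  show ?thesis
  proof
    show "densely_defined A" by (fact dense)
    show "A \<subseteq> ?A0" by (fact A_A0)
    show "?A0 \<subseteq> cadjoint A" using A0_T T(1) by blast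
    show "selfadjoint_op ?A0" by (fact sa)
    show "clinear_on (Domain ?A0) \<Gamma>1"
      using lin sub unfolding clinear_on_def Domain_restr_ker_in by blast
    show "\<Gamma>1 f = 0" if dom: "f \<in> Domain A" for f
    proof -
      obtain f' where f: "(f, f') \<in> A" using dom by blast
      then have fT: "(f, f') \<in> T" "\<Gamma>0 f = 0" using A_A0 by (auto simp: mem_restr_ker_in)
      have orthogonal: "cinner (\<Gamma>0 h) (\<Gamma>1 f) = 0" if h: "h \<in> Domain T" for h
      proof -
        obtain h' where h': "(h, h') \<in> T" using h by blast
        have "cinner f' h = cinner f h'" using h' T(1) f by (intro cadjointD[of _ _ A]) auto
        then have "cinner h' f = cinner h f'" by (metis cinner_commute)
        then show ?thesis using green[OF h' fT(1)] fT(2) by simp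
      qed
      have "closed {p :: 'g \<times> 'g. cinner (fst p) (\<Gamma>1 f) = 0}"
        by (intro closed_Collect_eq continuous_intros)
      then have "closure ((\<lambda>f. (\<Gamma>0 f, \<Gamma>1 f)) ` Domain T) \<subseteq> {p. cinner (fst p) (\<Gamma>1 f) = 0}"
        using orthogonal by (intro closure_minimal image_subsetI) simp_all
      then have "(\<Gamma>1 f, 0) \<in> {p :: 'g \<times> 'g. cinner (fst p) (\<Gamma>1 f) = 0}" unfolding range by blast
      then have "cinner (\<Gamma>1 f) (\<Gamma>1 f) = 0" by simp
      then show ?thesis by (simp add: cinner_self)
    qed
    show "\<exists>C\<ge>0. \<forall>(g, g')\<in>?A0. N1 (\<Gamma>1 g) \<le> C * (norm g + norm g')"
    proof -
      obtain \<nu> C where C: "\<And>h f. (h, f) \<in> resolvent ?A0 (cnj \<nu>) \<Longrightarrow> N1 (\<Gamma>1 f) \<le> C * norm h"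
        using continuous unfolding continuous_after_resolvent_def by blast
      have "N1 (\<Gamma>1 g) \<le> (\<bar>C\<bar> * (1 + cmod \<nu>)) * (norm g + norm g')" if g: "(g, g') \<in> ?A0" for g g'
      proof -
        have "(g' - cnj \<nu> *\<^sub>C g, g) \<in> resolvent ?A0 (cnj \<nu>)" using g by (simp add: in_resolvent)
        then have "N1 (\<Gamma>1 g) \<le> C * norm (g' - cnj \<nu> *\<^sub>C g)" by (rule C)
        also have "\<dots> \<le> \<bar>C\<bar> * norm (g' - cnj \<nu> *\<^sub>C g)" by (rule mult_right_mono) auto
        also have "norm (g' - cnj \<nu> *\<^sub>C g) \<le> norm g' + cmod \<nu> * norm g"
          using norm_triangle_ineq4[of g' "cnj \<nu> *\<^sub>C g"] by (simp add: norm_scaleC)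
        also have "\<dots> \<le> (1 + cmod \<nu>) * (norm g + norm g')"
          by (simp add: algebra_simps)
        finally show ?thesis by (simp add: mult.assoc mult_left_mono)
      qed
      moreover have "0 \<le> \<bar>C\<bar> * (1 + cmod \<nu>)" by simp
      ultimately show ?thesis by blast
    qed
    show "G1 = \<Gamma>1 ` Domain ?A0" by (fact G1')
    show "norm_on G1 N1" "\<exists>C. \<forall>x\<in>G1. norm x \<le> C * N1 x"
      using N1 unfolding reflexive_banach_embedded_def by blast+
    show "?E0 f \<in> antidual G1 N1" if "f \<in> Domain (cadjoint A)" for f
      using E0 that unfolding is_extended_boundary_map_def by blast
    show "clinear_on (Domain (cadjoint A)) ?E0"
      "\<exists>C. \<forall>(f, f')\<in>cadjoint A. antidual_norm G1 N1 (?E0 f) \<le> C * norm (f, f')"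
      using E0 unfolding is_extended_boundary_map_def by blast+
    show "?E0 f (\<Gamma>1 g) = cinner f g' - cinner f' g"
      if "(f, f') \<in> cadjoint A" "(g, g') \<in> ?A0" for f f' g g'
    proof -
      have "(g, g') \<in> T" "g \<in> ker_in T \<Gamma>0" using that(2) by (auto simp: restr_def)
      then show ?thesis using pairing[OF that(1)] by simp
    qed
  qed
qed

lemma is_extended_boundary_map_Gamma1:
  fixes A T :: "('h::complex_hilbert \<times> 'h) set" and \<Gamma>0 \<Gamma>1 :: "'h \<Rightarrow> 'g::complex_hilbert"
  assumes A: "symmetric_op A" and triple: "quasi_boundary_triple A T \<Gamma>0 \<Gamma>1"
    and G0: "G0 = \<Gamma>0 ` ker_in T \<Gamma>1" and N0: "reflexive_banach_embedded G0 N0"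
  shows "is_extended_boundary_map (cadjoint A) T \<Gamma>1 G0 N0
    (extended_boundary_map (cadjoint A) T \<Gamma>1 G0 N0)"
proof -
  have dense: "densely_defined A" using A by (simp add: symmetric_op_def)
  have T: "closure T = cadjoint A"
    and green: "\<And>f f' g g'. (f, f') \<in> T \<Longrightarrow> (g, g') \<in> T \<Longrightarrow>
      cinner f' g - cinner f g' = cinner (\<Gamma>1 f) (\<Gamma>0 g) - cinner (\<Gamma>0 f) (\<Gamma>1 g)"
    using triple unfolding quasi_boundary_triple_def by blast+
  have green1: "cinner (\<Gamma>1 f) (\<Gamma>0 g) = 1 * (cinner f' g - cinner f g')"
    if "(f, f') \<in> T" "(g, g') \<in> T" "g \<in> ker_in T \<Gamma>1" for f f' g g'
    using green[OF that(1,2)] that(3) by (simp add: ker_in_def)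
  have sub: "ker_in T \<Gamma>1 \<subseteq> Domain T" by (auto simp: ker_in_def)
  show ?thesis
    by (rule extended_boundary_map_characterization(1)[OF csubspace_cadjoint single_valued_cadjoint[OF dense] T N0 G0 sub])
      (rule green1)
qed

context extended_gamma_field
begin

text \<open>
  Krein's formula, before anything is known about \<open>\<mu>\<close> and the extension: writing
  \<open>f = resolvent_op A0 \<mu> h + \<gamma> \<mu> \<phi>\<close> one has \<open>E0 f = \<phi>\<close> and \<open>E1 f = embed G0 (L \<mu> h) + E1 (\<gamma> \<mu> \<phi>)\<close>, so the
  boundary condition on \<open>f\<close> becomes a condition on \<open>\<phi>\<close> and \<open>h\<close>.
\<close>

lemma boundary_extension_iff:
  fixes G0 :: "'g set" and E1 :: "'h \<Rightarrow> 'g \<Rightarrow> complex"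
  assumes \<mu>: "\<mu> \<in> resolvent_set A0"
    and E1: "clinear_on (Domain (cadjoint A)) E1" "\<And>f. f \<in> Domain A0 \<Longrightarrow> E1 f = embed G0 (\<Gamma>1 f)"
  shows "(f, h + \<mu> *\<^sub>C f) \<in> boundary_extension (cadjoint A) E0 E1 \<theta> \<longleftrightarrow>
    (\<exists>\<phi>\<in>antidual G1 N1. (\<phi>, embed G0 (L \<mu> h) + E1 (\<gamma> \<mu> \<phi>)) \<in> \<theta>
      \<and> f = resolvent_op A0 \<mu> h + \<gamma> \<mu> \<phi>)"
    (is "?lhs \<longleftrightarrow> ?rhs")
proof -
  have mem: "(f, f') \<in> boundary_extension (cadjoint A) E0 E1 \<theta> \<longleftrightarrow>
      (f, f') \<in> cadjoint A \<and> (E0 f, E1 f) \<in> \<theta>" for f f'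
    by (auto simp: boundary_extension_def restr_def)
  let ?g = "resolvent_op A0 \<mu> h"
  have g: "(?g, h + \<mu> *\<^sub>C ?g) \<in> cadjoint A" "(?g, h + \<mu> *\<^sub>C ?g) \<in> A0"
    using resolvent_op_mem[OF \<mu>] A(3) by auto
  have g_E0: "E0 ?g = 0" using E0_eq_0_iff[OF g(1)] g(2) by simp
  have decomp: "(?g + \<gamma> \<mu> \<phi>, h + \<mu> *\<^sub>C (?g + \<gamma> \<mu> \<phi>)) \<in> cadjoint A"
      "E0 (?g + \<gamma> \<mu> \<phi>) = \<phi>" "E1 (?g + \<gamma> \<mu> \<phi>) = embed G0 (L \<mu> h) + E1 (\<gamma> \<mu> \<phi>)"
    if \<phi>: "\<phi> \<in> antidual G1 N1" for \<phi>
  proof -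
    note k = gamma_mem[OF \<mu> \<phi>]
    show "(?g + \<gamma> \<mu> \<phi>, h + \<mu> *\<^sub>C (?g + \<gamma> \<mu> \<phi>)) \<in> cadjoint A"
      using csubspace_add[OF csubspace_cadjoint g(1) k] by (simp add: scaleC_add_right add.assoc)
    have "E0 (?g + \<gamma> \<mu> \<phi>) = E0 ?g + E0 (\<gamma> \<mu> \<phi>)"
      using E0_linear g(1) k unfolding clinear_on_def by blast
    then show "E0 (?g + \<gamma> \<mu> \<phi>) = \<phi>" using g_E0 E0_gamma[OF \<mu> \<phi>] by simp
    have "E1 (?g + \<gamma> \<mu> \<phi>) = E1 ?g + E1 (\<gamma> \<mu> \<phi>)"
      using E1(1) g(1) k unfolding clinear_on_def by blast
    then show "E1 (?g + \<gamma> \<mu> \<phi>) = embed G0 (L \<mu> h) + E1 (\<gamma> \<mu> \<phi>)"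
      using E1(2)[OF DomainI[OF g(2)]] by (simp add: L_def)
  qed
  show ?thesis
  proof
    assume ?lhs
    then have f: "(f, h + \<mu> *\<^sub>C f) \<in> cadjoint A" "(E0 f, E1 f) \<in> \<theta>" by (simp_all add: mem)
    have \<phi>: "E0 f \<in> antidual G1 N1" using E0_antidual f(1) by blast
    have "f = ?g + \<gamma> \<mu> (E0 f)" using decomposition[OF \<mu> f(1)] by simp
    then show ?rhs using decomp(3)[OF \<phi>] f(2) \<phi> by metis
  next
    assume ?rhs
    then show ?lhs using decomp by (auto simp: mem)
  qed
qed

end

theorem corollary3p14:
  fixes A T A0 A1 :: "('h::complex_hilbert \<times> 'h) set"
    and \<Gamma>0 \<Gamma>1 :: "'h \<Rightarrow> 'g::complex_hilbert"
    and G0 G1 :: "'g set"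
    and N0 N1 :: "'g \<Rightarrow> real"
    and G0' G1' :: "('g \<Rightarrow> complex) set"
    and E0 E1 :: "'h \<Rightarrow> 'g \<Rightarrow> complex"
    and \<gamma> :: "complex \<Rightarrow> ('g \<Rightarrow> complex) \<Rightarrow> 'h"
    and M :: "complex \<Rightarrow> (('g \<Rightarrow> complex) \<times> ('g \<Rightarrow> complex)) set"
    and \<iota>p :: "'g \<Rightarrow> 'g"
    and \<iota>m :: "('g \<Rightarrow> complex) \<Rightarrow> 'g"
    and \<theta> :: "(('g \<Rightarrow> complex) \<times> ('g \<Rightarrow> complex)) set"
    and A\<theta> :: "('h \<times> 'h) set"
    and R :: "complex \<Rightarrow> (('g \<Rightarrow> complex) \<times> 'g) set"
    and RG :: "complex \<Rightarrow> ('g \<times> 'g) set"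
  assumes "separable_space (euclidean :: 'h topology)"
    and "symmetric_op A" and "closed A"
    and "quasi_boundary_triple A T \<Gamma>0 \<Gamma>1"
    and A0: "A0 = restr T (ker_in T \<Gamma>0)"
    and A1: "A1 = restr T (ker_in T \<Gamma>1)"
    and "selfadjoint_op A1"
    and "\<exists>\<eta>::real. complex_of_real \<eta> \<in> resolvent_set A0"
    and G0: "G0 = \<Gamma>0 ` ker_in T \<Gamma>1" and "closure G0 = UNIV"
    and G1: "G1 = \<Gamma>1 ` ker_in T \<Gamma>0" and "closure G1 = UNIV"
    and "reflexive_banach_embedded G0 N0" and "continuous_after_resolvent A1 \<Gamma>0 N0"
    and "reflexive_banach_embedded G1 N1" and "continuous_after_resolvent A0 \<Gamma>1 N1"
    and G0': "G0' = antidual G0 N0"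
    and G1': "G1' = antidual G1 N1"
    and E0: "E0 = extended_boundary_map (cadjoint A) T \<Gamma>0 G1 N1"
    and E1: "E1 = extended_boundary_map (cadjoint A) T \<Gamma>1 G0 N0"
    and \<gamma>: "\<gamma> = extended_gamma (cadjoint A) E0"
    and M: "M = (\<lambda>\<mu>. op_graph G1' (extended_weyl (cadjoint A) E0 E1 \<mu>))"
    and "isometric_identifications G1 N1 \<iota>p \<iota>m"
    and "csubspace \<theta>" and "\<theta> \<subseteq> G1' \<times> G0'"
    and "\<theta> \<subseteq> (\<lambda>f. (E0 f, E1 f)) ` Domain (cadjoint A)"
    and A\<theta>: "A\<theta> = boundary_extension (cadjoint A) E0 E1 \<theta>"
    and "closed A\<theta>"
    and R: "R = (\<lambda>\<mu>. values_in G1 G0 (\<theta> \<boxminus> M \<mu>))"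
    and RG: "RG = (\<lambda>\<mu>. op_graph G1 \<iota>p \<odot> R \<mu> \<odot> (op_graph G1' \<iota>m)\<inverse>)"
  shows "\<forall>\<mu> \<in> resolvent_set A0.
      ((\<mu> \<in> point_spectrum A\<theta> \<longleftrightarrow> 0 \<in> point_spectrum (RG \<mu>))
        \<and> (\<mu> \<in> point_spectrum A\<theta> \<longrightarrow>
             rel_ker (A\<theta> \<boxminus> scalar_rel \<mu>) = \<gamma> \<mu> ` rel_ker (\<theta> \<boxminus> M \<mu>)))
      \<and> (\<mu> \<in> continuous_spectrum A\<theta> \<longleftrightarrow> 0 \<in> continuous_spectrum (RG \<mu>))
      \<and> (\<mu> \<in> residual_spectrum A\<theta> \<longleftrightarrow> 0 \<in> residual_spectrum (RG \<mu>))
      \<and> ((\<mu> \<in> resolvent_set A\<theta> \<longleftrightarrow> 0 \<in> resolvent_set (RG \<mu>))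
        \<and> (\<mu> \<in> resolvent_set A\<theta> \<longrightarrow>
             resolvent A\<theta> \<mu> = resolvent A0 \<mu>
               \<boxplus> (op_graph G1' (\<gamma> \<mu>) \<odot> (R \<mu>)\<inverse> \<odot> op_graph UNIV (dual_map G1 N1 (\<gamma> (cnj \<mu>))))))"
proof
  fix \<mu> assume \<mu>: "\<mu> \<in> resolvent_set A0"
  note symmetric = assms(2) and triple = assms(4) and iso = assms(23)
  interpret field: extended_gamma_field A A0 \<Gamma>1 G1 N1 E0
    unfolding A0 E0
    by (rule extended_gamma_field_quasi_boundary_triple[OF symmetric triple G1 assms(15)])
      (use assms(16) A0 in simp)
  have E1_ext: "is_extended_boundary_map (cadjoint A) T \<Gamma>1 G0 N0 E1"
    unfolding E1 by (rule is_extended_boundary_map_Gamma1[OF symmetric triple G0 assms(13)])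
  have E1_linear: "clinear_on (Domain (cadjoint A)) E1"
    using E1_ext unfolding is_extended_boundary_map_def by blast
  have E1_A0: "E1 f = embed G0 (\<Gamma>1 f)" if "f \<in> Domain A0" for f
    using E1_ext that A0 Domain_restr_ker_in[of T \<Gamma>0]
    unfolding is_extended_boundary_map_def ker_in_def by blast
  have \<iota>p: "clinear_on G1 \<iota>p" "\<iota>p ` G1 = UNIV" "\<And>x. x \<in> G1 \<Longrightarrow> norm (\<iota>p x) = N1 x"
    and \<iota>m: "\<iota>m ` G1' = UNIV" "\<And>\<phi>. \<phi> \<in> G1' \<Longrightarrow> norm (\<iota>m \<phi>) = antidual_norm G1 N1 \<phi>"
    and \<iota>_pairing: "\<And>x \<phi>. x \<in> G1 \<Longrightarrow> \<phi> \<in> G1' \<Longrightarrow> cinner (\<iota>m \<phi>) (\<iota>p x) = \<phi> x"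
    using iso unfolding isometric_identifications_def G1' by blast+
  have \<iota>p_inj: "x = y" if "x \<in> G1" "y \<in> G1" "\<iota>p x = \<iota>p y" for x y
  proof -
    have xy: "x - y \<in> G1" using that csubspace_diff[OF field.csubspace_G1] by blast
    have "\<iota>p (x - y) = 0" using clinear_on_diff[OF \<iota>p(1) field.csubspace_G1 that(1,2)] that(3) by simp
    then have "N1 (x - y) = 0" using \<iota>p(3)[OF xy] by simp
    then show ?thesis using field.N1(1) xy by (simp add: norm_on_def)
  qed
  have \<iota>m_inj: "inj_on \<iota>m G1'"
  proof (rule inj_onI)
    fix \<phi> \<psi> assume \<phi>: "\<phi> \<in> G1'" and \<psi>: "\<psi> \<in> G1'" and eq: "\<iota>m \<phi> = \<iota>m \<psi>"
    have "\<phi> x = \<psi> x" if "x \<in> G1" for x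
      using \<iota>_pairing[OF that \<phi>] \<iota>_pairing[OF that \<psi>] eq by simp
    then show "\<phi> = \<psi>" using \<phi> \<psi> unfolding G1' by (intro antidual_ext)
  qed
  define \<iota> where "\<iota> = the_inv_into G1' \<iota>m"
  have \<iota>: "\<iota> (\<iota>m \<phi>) = \<phi>" if "\<phi> \<in> G1'" for \<phi>
    unfolding \<iota>_def by (rule the_inv_into_f_f[OF \<iota>m_inj that])

  have mem_R: "(\<phi>, x) \<in> R \<mu> \<longleftrightarrow> \<phi> \<in> G1' \<and> x \<in> G1 \<and> (\<phi>, embed G0 x + E1 (\<gamma> \<mu> \<phi>)) \<in> \<theta>" for \<phi> x
  proof -
    have "(\<phi>, x) \<in> R \<mu> \<longleftrightarrow> \<phi> \<in> G1' \<and> x \<in> G1 \<and> (\<exists>\<psi>. (\<phi>, \<psi>) \<in> \<theta> \<and> embed G0 x = \<psi> - E1 (\<gamma> \<mu> \<phi>))"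
      unfolding R values_in_def M rel_diff_def op_graph_def extended_weyl_def \<gamma> by auto
    also have "\<dots> \<longleftrightarrow> \<phi> \<in> G1' \<and> x \<in> G1 \<and> (\<phi>, embed G0 x + E1 (\<gamma> \<mu> \<phi>)) \<in> \<theta>"
      by (auto simp: eq_diff_eq)
    finally show ?thesis .
  qed
  have mem_RG: "(y, z) \<in> RG \<mu> \<longleftrightarrow> (\<exists>\<phi> x. (\<phi>, x) \<in> R \<mu> \<and> y = \<iota>m \<phi> \<and> z = \<iota>p x)" for y z
    unfolding RG op_graph_def using mem_R by auto
  have A\<theta>_iff: "(f, h + \<mu> *\<^sub>C f) \<in> A\<theta> \<longleftrightarrow>
      (\<exists>\<phi>. (\<phi>, field.L \<mu> h) \<in> R \<mu> \<and> f = resolvent_op A0 \<mu> h + \<gamma> \<mu> \<phi>)" for f h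
  proof -
    have "(f, h + \<mu> *\<^sub>C f) \<in> A\<theta> \<longleftrightarrow>
        (\<exists>\<phi>\<in>antidual G1 N1. (\<phi>, embed G0 (field.L \<mu> h) + E1 (field.\<gamma> \<mu> \<phi>)) \<in> \<theta>
          \<and> f = resolvent_op A0 \<mu> h + field.\<gamma> \<mu> \<phi>)"
      unfolding A\<theta> by (rule field.boundary_extension_iff[OF \<mu> E1_linear]) (rule E1_A0)
    then show ?thesis unfolding mem_R \<gamma> G1' using field.L_mem[OF \<mu>] by blast
  qed

  (* The two isometric identifications turn L \<mu> and \<gamma> \<mu> into maps to and from 'g; as \<iota>p and \<iota>m are
     injective on G1 and G1', no pair of R \<mu> is lost or added in RG \<mu>. *)
  interpret krein_link A\<theta> \<mu> "RG \<mu>" "resolvent_op A0 \<mu>" "\<lambda>h. \<iota>p (field.L \<mu> h)" "\<lambda>y. \<gamma> \<mu> (\<iota> y)"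
  proof
    show "(f, h + \<mu> *\<^sub>C f) \<in> A\<theta> \<longleftrightarrow>
        (\<exists>y. (y, \<iota>p (field.L \<mu> h)) \<in> RG \<mu> \<and> f = resolvent_op A0 \<mu> h + \<gamma> \<mu> (\<iota> y))" for f h
    proof
      assume "(f, h + \<mu> *\<^sub>C f) \<in> A\<theta>"
      then obtain \<phi> where \<phi>: "(\<phi>, field.L \<mu> h) \<in> R \<mu>" "f = resolvent_op A0 \<mu> h + \<gamma> \<mu> \<phi>"
        unfolding A\<theta>_iff by blast
      then have "(\<iota>m \<phi>, \<iota>p (field.L \<mu> h)) \<in> RG \<mu>" "\<iota> (\<iota>m \<phi>) = \<phi>" using \<iota> mem_R mem_RG by blast+
      then show "\<exists>y. (y, \<iota>p (field.L \<mu> h)) \<in> RG \<mu> \<and> f = resolvent_op A0 \<mu> h + \<gamma> \<mu> (\<iota> y)"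
        using \<phi>(2) by metis
    next
      assume "\<exists>y. (y, \<iota>p (field.L \<mu> h)) \<in> RG \<mu> \<and> f = resolvent_op A0 \<mu> h + \<gamma> \<mu> (\<iota> y)"
      then obtain \<phi> x where \<phi>: "(\<phi>, x) \<in> R \<mu>" "\<iota>p (field.L \<mu> h) = \<iota>p x"
        "f = resolvent_op A0 \<mu> h + \<gamma> \<mu> (\<iota> (\<iota>m \<phi>))" unfolding mem_RG by blast
      then have "field.L \<mu> h = x" using \<iota>p_inj field.L_mem[OF \<mu>] mem_R by blast
      then show "(f, h + \<mu> *\<^sub>C f) \<in> A\<theta>" using \<phi> \<iota> mem_R unfolding A\<theta>_iff by auto
    qed
    show "\<exists>C\<ge>0. \<forall>h. norm (resolvent_op A0 \<mu> h) \<le> C * norm h" by (rule resolvent_op_bounded[OF \<mu>])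
    show "\<iota>p (field.L \<mu> (h + k)) = \<iota>p (field.L \<mu> h) + \<iota>p (field.L \<mu> k)" for h k
      using \<iota>p(1) field.L_mem[OF \<mu>] field.L_add[OF \<mu>] unfolding clinear_on_def by simp
    show "\<exists>C\<ge>0. \<forall>h. norm (\<iota>p (field.L \<mu> h)) \<le> C * norm h"
      using field.L_bounded[OF \<mu>] by (simp add: \<iota>p(3) field.L_mem[OF \<mu>])
    show "\<exists>C\<ge>0. \<forall>x. \<exists>h. \<iota>p (field.L \<mu> h) = x \<and> norm h \<le> C * norm x"
    proof -
      obtain C where C: "C \<ge> 0" "\<And>x. x \<in> G1 \<Longrightarrow> \<exists>h. field.L \<mu> h = x \<and> norm h \<le> C * N1 x"
        using field.L_bounded_right_inverse[OF \<mu>] by blast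
      have "\<exists>h. \<iota>p (field.L \<mu> h) = z \<and> norm h \<le> C * norm z" for z
      proof -
        obtain x where x: "x \<in> G1" "\<iota>p x = z" using \<iota>p(2) by (metis UNIV_I imageE)
        then show ?thesis using C(2)[OF x(1)] \<iota>p(3)[OF x(1)] by auto
      qed
      then show ?thesis using C(1) by blast
    qed
    have rep: "\<iota> y \<in> G1'" "\<iota>m (\<iota> y) = y" for y
    proof -
      have "y \<in> \<iota>m ` G1'" using \<iota>m(1) by simp
      then show "\<iota> y \<in> G1'" "\<iota>m (\<iota> y) = y" using \<iota> by auto
    qed
    have norm_\<iota>: "norm y = antidual_norm G1 N1 (\<iota> y)" for y
      using \<iota>m(2)[OF rep(1)[of y]] rep(2)[of y] by simp
    have E0_left_inverse: "E0 (\<gamma> \<mu> \<phi>) = \<phi>" if "\<phi> \<in> G1'" for \<phi>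
      using field.E0_gamma[OF \<mu>] that by (simp add: \<gamma> G1')
    show "inj (\<lambda>y. \<gamma> \<mu> (\<iota> y))"
    proof (rule injI)
      fix y z assume eq: "\<gamma> \<mu> (\<iota> y) = \<gamma> \<mu> (\<iota> z)"
      have "\<iota> y = E0 (\<gamma> \<mu> (\<iota> y))" using E0_left_inverse[OF rep(1)] by simp
      also have "\<dots> = \<iota> z" unfolding eq by (rule E0_left_inverse[OF rep(1)])
      finally have "\<iota>m (\<iota> y) = \<iota>m (\<iota> z)" by (rule arg_cong)
      then show "y = z" unfolding rep(2) .
    qed
    show "\<exists>C\<ge>0. \<forall>y. norm (\<gamma> \<mu> (\<iota> y)) \<le> C * norm y"
      using field.gamma_bounded[OF \<mu>] rep(1) unfolding norm_\<iota> \<gamma> G1' by blast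
    show "\<exists>C\<ge>0. \<forall>y. norm y \<le> C * norm (\<gamma> \<mu> (\<iota> y))"
    proof -
      obtain C where C: "C \<ge> 0"
        "\<And>k. (k, \<mu> *\<^sub>C k) \<in> cadjoint A \<Longrightarrow> antidual_norm G1 N1 (E0 k) \<le> C * norm k"
        using field.E0_bounded_on_kernel[OF \<mu>] by blast
      have "norm y \<le> C * norm (\<gamma> \<mu> (\<iota> y))" for y
      proof -
        have "(\<gamma> \<mu> (\<iota> y), \<mu> *\<^sub>C \<gamma> \<mu> (\<iota> y)) \<in> cadjoint A"
          using field.gamma_mem[OF \<mu>] rep(1) unfolding \<gamma> G1' by blast
        then show ?thesis using C(2) E0_left_inverse[OF rep(1)] by (fastforce simp: norm_\<iota>)
      qed
      then show ?thesis using C(1) by blast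
    qed
  qed
  have kernel: "rel_ker (A\<theta> \<boxminus> scalar_rel \<mu>) = \<gamma> \<mu> ` rel_ker (\<theta> \<boxminus> M \<mu>)"
  proof -
    have "embed G0 0 = 0" by (auto simp: embed_def)
    then have "(\<phi>, 0) \<in> R \<mu> \<longleftrightarrow> (\<phi>, 0) \<in> \<theta> \<boxminus> M \<mu>" for \<phi>
      unfolding mem_R using csubspace_0[OF field.csubspace_G1]
      by (auto simp: M rel_diff_def op_graph_def extended_weyl_def \<gamma>)
    moreover have "field.L \<mu> 0 = 0" using field.L_scaleC[OF \<mu>, of 0 0] by simp
    ultimately have "(f, \<mu> *\<^sub>C f) \<in> A\<theta> \<longleftrightarrow> (\<exists>\<phi>. (\<phi>, 0) \<in> \<theta> \<boxminus> M \<mu> \<and> f = \<gamma> \<mu> \<phi>)" for f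
      using A\<theta>_iff[of f 0] zeros(1) by simp
    then show ?thesis unfolding rel_ker_diff_scalar unfolding rel_ker_def by auto
  qed
  have krein: "resolvent A\<theta> \<mu> = resolvent A0 \<mu>
      \<boxplus> (op_graph G1' (\<gamma> \<mu>) \<odot> (R \<mu>)\<inverse> \<odot> op_graph UNIV (dual_map G1 N1 (\<gamma> (cnj \<mu>))))"
  proof -
    have dual: "dual_map G1 N1 (\<gamma> (cnj \<mu>)) = field.L \<mu>"
      unfolding \<gamma> using field.dual_map_gamma[OF \<mu>] by blast
    let ?Z = "op_graph G1' (\<gamma> \<mu>) \<odot> (R \<mu>)\<inverse> \<odot> op_graph UNIV (field.L \<mu>)"
    have "\<phi> \<in> G1'" if "(\<phi>, x) \<in> R \<mu>" for \<phi> x using that mem_R by blast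
    then have "(h, k) \<in> ?Z \<longleftrightarrow> (\<exists>\<phi>. (\<phi>, field.L \<mu> h) \<in> R \<mu> \<and> k = \<gamma> \<mu> \<phi>)" for h k
      by (auto simp: op_graph_def relcomp_unfold)
    then have "(h, f) \<in> resolvent A0 \<mu> \<boxplus> ?Z \<longleftrightarrow>
        (\<exists>\<phi>. (\<phi>, field.L \<mu> h) \<in> R \<mu> \<and> f = resolvent_op A0 \<mu> h + \<gamma> \<mu> \<phi>)" for h f
      unfolding resolvent_eq_op_graph[OF \<mu>] rel_sum_def by (auto simp: op_graph_def)
    then have "(h, f) \<in> resolvent A\<theta> \<mu> \<longleftrightarrow> (h, f) \<in> resolvent A0 \<mu> \<boxplus> ?Z" for h f
      by (simp add: in_resolvent[of h f A\<theta>] A\<theta>_iff)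
    then show ?thesis unfolding dual by auto
  qed
  show "((\<mu> \<in> point_spectrum A\<theta> \<longleftrightarrow> 0 \<in> point_spectrum (RG \<mu>))
        \<and> (\<mu> \<in> point_spectrum A\<theta> \<longrightarrow>
             rel_ker (A\<theta> \<boxminus> scalar_rel \<mu>) = \<gamma> \<mu> ` rel_ker (\<theta> \<boxminus> M \<mu>)))
      \<and> (\<mu> \<in> continuous_spectrum A\<theta> \<longleftrightarrow> 0 \<in> continuous_spectrum (RG \<mu>))
      \<and> (\<mu> \<in> residual_spectrum A\<theta> \<longleftrightarrow> 0 \<in> residual_spectrum (RG \<mu>))
      \<and> ((\<mu> \<in> resolvent_set A\<theta> \<longleftrightarrow> 0 \<in> resolvent_set (RG \<mu>))
        \<and> (\<mu> \<in> resolvent_set A\<theta> \<longrightarrow>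
             resolvent A\<theta> \<mu> = resolvent A0 \<mu>
               \<boxplus> (op_graph G1' (\<gamma> \<mu>) \<odot> (R \<mu>)\<inverse> \<odot> op_graph UNIV (dual_map G1 N1 (\<gamma> (cnj \<mu>))))))"
    using point_spectrum_iff continuous_spectrum_iff residual_spectrum_iff resolvent_set_iff
      kernel krein by simp
qed

end
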